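(* Let $p$ be a prime and $m\in\mathbb{F}_p$, and let $G$ be the group of symmetries of the set $I$ (the isometries of the square $[0,1]^2$ mapping $I$ onto itself, a subgroup of the dihedral group $D_8$ of the square). Exactly one of the following holds: (1) $m = 0$. Then $I$ is a self-similar Pascal Triangle, $I$ is symmetric only with respect to the first diagonal, and $G$ is isomorphic to $S_2$ (it consists of the identity and the reflection in the first diagonal). (2) $m = \pm1$. Then $I$ is the full square (for $m=-1$) or a non-trivial self-similar set (for $m=1$), and $G$ is the full dihedral group $D_8$. (3) $p\ge5$ and $m\in\mathbb{F}_p\setminus\{-1,0,1\}$. Then $I$ is a non-trivial self-similar set and $G$ is generated by the reflections in the two diagonals of the square; $G$ is isomorphic to Klein's group $K_4$.
   Context: For $d\ge1$, $M_d = (a_{i,j})_{0\le i,j\le p^d-1}$ is the $p^d\times p^d$ matrix over $\mathbb{F}_p$ with $a_{i,0} = a_{0,j}=1$ and $a_{i,j} = a_{i-1,j} + m\,a_{i-1,j-1} + a_{i,j-1}$ for $i,j\ge1$. The black and white image $I^d$ of $M_d$ is obtained by tiling $[0,1]^2$ into $p^d\times p^d$ equal closed squares $S_{i,j}$ (row $i$, column $j$) and removing the interior of $S_{i,j}$ exactly when $a_{i,j}=0$; $I = \lim I^d$ in the Hausdorff metric. The first diagonal of the square is the one corresponding to the main diagonal $\{(i,i)\}$ of the matrices (reflection in it corresponds to transposition); the second diagonal corresponds to $\{(i, p^d-1-i)\}$. A non-trivial self-similar set means the limit of the images of the tensor powers $D^{\otimes d}$ of a $\{0,1\}$-matrix $D$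 with at least one zero and at least two ones, where $A\otimes B = (a_{i,j}B)$.
   Formalization: I^d is taken as the union of the closed squares with nonzero entry (removing only interiors keeps the whole grid, so I would be the full square for every m); and for p=2, where m=1=-1 and I is the full square, the claim that I is non-trivially self-similar for m=1 is not made. *)

theory Defs
  imports
    "HOL-Analysis.Elementary_Metric_Spaces"
    "HOL-Analysis.Product_Vector"
    "HOL-Algebra.Bij"
    "HOL-Algebra.Generated_Groups"
    "HOL-Algebra.Elementary_Groups"
    "HOL-Algebra.Sym_Groups"
    "Jordan_Normal_Form.Matrix"
    "Berlekamp_Zassenhaus.Finite_Field"
begin

fun arr :: "'a::comm_ring_1 \<Rightarrow> nat \<Rightarrow> nat \<Rightarrow> 'a" where
  "arr m 0 j = 1"
| "arr m (Suc i) 0 = 1"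
| "arr m (Suc i) (Suc j) = arr m i (Suc j) + m * arr m i j + arr m (Suc i) j"

definition M_mat :: "'p::prime_card mod_ring \<Rightarrow> nat \<Rightarrow> 'p mod_ring mat" where
  "M_mat m d = mat (CARD('p) ^ d) (CARD('p) ^ d) (\<lambda>(i, j). arr m i j)"

definition unit_square :: "(real \<times> real) set" where
  "unit_square = {0..1} \<times> {0..1}"

text \<open>
  Points are written in matrix coordinates: the first coordinate runs along the row index,
  the second one along the column index. Thus the first diagonal of the square is
  \<open>{(t, t)}\<close> and the second one is \<open>{(t, 1 - t)}\<close>.
\<close>

definition cell :: "nat \<Rightarrow> nat \<Rightarrow> nat \<Rightarrow> (real \<times> real) set" where
  "cell n i j = {real i / real n .. real (Suc i) / real n} \<times> {real j / real n .. real (Suc j) / real n}"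

text \<open>
  The image of a square matrix. Removing a cell with zero entry removes its interior and also
  the edges and vertices that belong to no remaining cell; what is left is the union of
  the closed cells with nonzero entry. (If all edges were kept, every image would contain the
  whole grid and every sequence of images would converge to the full square.)
\<close>

definition bw_image :: "'a::zero mat \<Rightarrow> (real \<times> real) set" where
  "bw_image A = (\<Union>i<dim_row A. \<Union>j\<in>{j. j < dim_col A \<and> A $$ (i, j) \<noteq> 0}. cell (dim_row A) i j)"

definition hausdorff_dist :: "'a::metric_space set \<Rightarrow> 'a set \<Rightarrow> real" where
  "hausdorff_dist A B = max (SUP x\<in>A. infdist x B) (SUP y\<in>B. infdist y A)"

text \<open>Convergence in the metric space of nonempty compact sets.\<close>

definition hausdorff_limit :: "(nat \<Rightarrow> 'a::metric_space set) \<Rightarrow> 'a set \<Rightarrow> bool" where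
  "hausdorff_limit X K \<longleftrightarrow>
     (\<forall>d. compact (X d) \<and> X d \<noteq> {}) \<and> compact K \<and> K \<noteq> {} \<and>
     (\<lambda>d. hausdorff_dist (X d) K) \<longlonglongrightarrow> 0"

definition limit_image :: "'p::prime_card mod_ring \<Rightarrow> (real \<times> real) set" where
  "limit_image m = (THE K. hausdorff_limit (\<lambda>d. bw_image (M_mat m d)) K)"

definition tensor_mat :: "'a::times mat \<Rightarrow> 'a mat \<Rightarrow> 'a mat" where
  "tensor_mat A B = mat (dim_row A * dim_row B) (dim_col A * dim_col B)
     (\<lambda>(i, j). A $$ (i div dim_row B, j div dim_col B) * B $$ (i mod dim_row B, j mod dim_col B))"

fun tensor_power :: "'a::semiring_1 mat \<Rightarrow> nat \<Rightarrow> 'a mat" where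
  "tensor_power D 0 = 1\<^sub>m 1"
| "tensor_power D (Suc d) = tensor_mat D (tensor_power D d)"

definition nontrivial_generator :: "nat mat \<Rightarrow> bool" where
  "nontrivial_generator D \<longleftrightarrow>
     square_mat D \<and>
     (\<forall>i<dim_row D. \<forall>j<dim_col D. D $$ (i, j) \<in> {0, 1}) \<and>
     card {(i, j). i < dim_row D \<and> j < dim_col D \<and> D $$ (i, j) = 0} \<ge> 1 \<and>
     card {(i, j). i < dim_row D \<and> j < dim_col D \<and> D $$ (i, j) = 1} \<ge> 2"

definition self_similar_from :: "nat mat \<Rightarrow> (real \<times> real) set \<Rightarrow> bool" where
  "self_similar_from D K \<longleftrightarrow>
     nontrivial_generator D \<and> hausdorff_limit (\<lambda>d. bw_image (tensor_power D d)) K"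

definition nontrivial_self_similar :: "(real \<times> real) set \<Rightarrow> bool" where
  "nontrivial_self_similar K \<longleftrightarrow> (\<exists>D. self_similar_from D K)"

definition pascal_mat :: "nat \<Rightarrow> nat \<Rightarrow> nat mat" where
  "pascal_mat p n = mat n n (\<lambda>(i, j). ((i + j) choose i) mod p)"

definition zero_pattern :: "'a::zero mat \<Rightarrow> nat mat" where
  "zero_pattern A = map_mat (\<lambda>x. if x = 0 then 0 else 1) A"

text \<open>
  The limit image of Pascal's triangle modulo \<open>p\<close> (written as the square array of the
  binomial coefficients \<open>(i + j) choose i\<close>), which moreover is self-similar, generated by the
  pattern of nonzero entries of the initial \<open>p \<times> p\<close> block of that triangle.
\<close>

definition self_similar_pascal_triangle :: "nat \<Rightarrow> (real \<times> real) set \<Rightarrow> bool" where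
  "self_similar_pascal_triangle p K \<longleftrightarrow>
     hausdorff_limit (\<lambda>d. bw_image (pascal_mat p (p ^ d))) K \<and>
     self_similar_from (zero_pattern (pascal_mat p p)) K"

definition square_isometries :: "(real \<times> real \<Rightarrow> real \<times> real) set" where
  "square_isometries =
     {f \<in> Bij unit_square. \<forall>x\<in>unit_square. \<forall>y\<in>unit_square. dist (f x) (f y) = dist x y}"

definition dihedral_square :: "(real \<times> real \<Rightarrow> real \<times> real) monoid" where
  "dihedral_square = BijGroup unit_square \<lparr>carrier := square_isometries\<rparr>"

definition symmetry_group :: "(real \<times> real) set \<Rightarrow> (real \<times> real \<Rightarrow> real \<times> real) monoid" where
  "symmetry_group K = dihedral_square \<lparr>carrier := {f \<in> square_isometries. f ` K = K}\<rparr>"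

definition refl_diag1 :: "real \<times> real \<Rightarrow> real \<times> real" where
  "refl_diag1 = (\<lambda>(x, y)\<in>unit_square. (y, x))"

definition refl_diag2 :: "real \<times> real \<Rightarrow> real \<times> real" where
  "refl_diag2 = (\<lambda>(x, y)\<in>unit_square. (1 - y, 1 - x))"

definition klein_four :: "(int \<times> int) monoid" where
  "klein_four = integer_mod_group 2 \<times>\<times> integer_mod_group 2"

definition exactly_one :: "bool \<Rightarrow> bool \<Rightarrow> bool \<Rightarrow> bool" where
  "exactly_one P Q R \<longleftrightarrow>
     (P \<and> \<not> Q \<and> \<not> R) \<or> (\<not> P \<and> Q \<and> \<not> R) \<or> (\<not> P \<and> \<not> Q \<and> R)"

end

theory Submission
  imports Defs
begin

text \<open>
  Writing \<open>a\<close> for the array \<open>arr m\<close>, one has \<open>a i j = (\<Sum>k. (i choose k) (j choose k) (1 + m)^k)\<close>, so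
  the last row of the initial \<open>p \<times> p\<close> block is \<open>a (p-1) j = (-m)^j\<close>. Hence \<open>a\<close> is multiplicative in
  base-\<open>p\<close> digits, the images are nested, and their limit is their intersection, the self-similar
  set generated by the first block. The symmetries come from the identities
  \<open>a i j = (-m)^(i+j) a (p-1-i) (p-1-j)\<close> for \<open>m \<noteq> 0\<close> and \<open>a i j = (-1)^i a i (p-1-j)\<close> for \<open>m = 1\<close>, both
  proved by checking that the right-hand side satisfies the recurrence.

  For \<open>m = 0\<close> exactly one corner of the square is missing from the limit, so every symmetry fixes it.
  For \<open>m \<noteq> -1\<close> row 1 of the first block has a single zero, at \<open>j = -1/(1+m)\<close>; invariance under
  \<open>y \<mapsto> 1 - y\<close> would force \<open>2 j = -1\<close>, that is \<open>m = 1\<close>.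
\<close>

section \<open>The array modulo \<open>p\<close>\<close>

lemma arr_0_right [simp]: "arr m i 0 = 1"
  by (cases i) auto

lemma arr_sym: "arr m i j = arr m j i"
  by (induction m i j rule: arr.induct) (auto simp: algebra_simps)

text \<open>The bound \<open>n\<close> confines the hypotheses on \<open>B\<close> to a finite
  square, because some formulas compared with the array below involve \<open>p - 1 - j\<close> and
  obey the recurrence only inside one block.\<close>

lemma arr_eqI:
  assumes B0: "\<And>j. j < n \<Longrightarrow> B 0 j = 1" "\<And>i. i < n \<Longrightarrow> B i 0 = 1"
    and BSuc: "\<And>i j. Suc i < n \<Longrightarrow> Suc j < n \<Longrightarrow>
      B (Suc i) (Suc j) = B i (Suc j) + m * B i j + B (Suc i) j"
    and "i < n" "j < n"
  shows "arr m i j = B i j"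
  using \<open>i < n\<close> \<open>j < n\<close>
proof (induction i arbitrary: j)
  case 0
  then show ?case by (simp add: B0)
next
  case (Suc i)
  from \<open>j < n\<close> show ?case
  proof (induction j)
    case 0
    then show ?case using Suc.prems by (simp add: B0)
  next
    case (Suc j)
    then show ?case using Suc.IH \<open>\<And>j. i < n \<Longrightarrow> j < n \<Longrightarrow> arr m i j = B i j\<close> \<open>Suc i < n\<close> by (simp add: BSuc)
  qed
qed

text \<open>Expanding the generating function 1 / ((1 - x) (1 - y) - (1 + m) x y) in powers of 1 + m
  gives this form. The upper limit \<open>n\<close> is free so that the sums in the induction can be
  brought to a common range.\<close>

lemma arr_eq_sum_choose:
  fixes m :: "'a::comm_ring_1"
  assumes "i \<le> n"
  shows "arr m i j = (\<Sum>k\<le>n. of_nat (i choose k) * of_nat (j choose k) * (1 + m) ^ k)"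
  using assms
proof (induction m i j arbitrary: n rule: arr.induct)
  case (1 m j)
  have "(\<Sum>k\<le>n. of_nat (0 choose k) * of_nat (j choose k) * (1 + m) ^ k)
      = (\<Sum>k\<le>n. if k = 0 then 1 else 0)"
    by (intro sum.cong) (auto simp: binomial_eq_0)
  then show ?case by (simp add: sum.delta)
next
  case (2 m i)
  have "(\<Sum>k\<le>n. of_nat (Suc i choose k) * of_nat (0 choose k) * (1 + m) ^ k)
      = (\<Sum>k\<le>n. if k = 0 then 1 else 0)"
    by (intro sum.cong) (auto simp: binomial_eq_0)
  then show ?case by (simp add: sum.delta)
next
  case (3 m i j)
  define w where "w = 1 + m"
  define S where "S i j n = (\<Sum>k\<le>n. of_nat (i choose k) * of_nat (j choose k) * w ^ k)" for i j n
  obtain l where n: "n = Suc l" and l: "i \<le> l" using 3(4) by (cases n) auto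
  have shift: "S i' j' (Suc l) = 1 + (\<Sum>k\<le>l. of_nat (i' choose Suc k) * of_nat (j' choose Suc k) * w ^ Suc k)"
    for i' j' unfolding S_def by (subst sum.atMost_Suc_shift) simp
  \<comment> \<open>By Pascal's rule the mixed second difference of
    \<open>(i choose Suc k) * (j choose Suc k)\<close> is
    \<open>(i choose k) * (j choose k)\<close>; the factor \<open>w\<close> and the shorter range
    \<open>l\<close> come from the index shift.\<close>
  have "S (Suc i) (Suc j) (Suc l) + S i j (Suc l) = S i (Suc j) (Suc l) + S (Suc i) j (Suc l) + w * S i j l"
    unfolding shift unfolding S_def
    by (simp add: sum.distrib[symmetric] sum_distrib_left algebra_simps)
  moreover have "arr m i (Suc j) = S i (Suc j) (Suc l)" "arr m (Suc i) j = S (Suc i) j (Suc l)"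
    "arr m i j = S i j (Suc l)" "arr m i j = S i j l"
    using 3(1)[of "Suc l"] 3(2)[of "Suc l"] 3(2)[of l] 3(3)[of "Suc l"] l by (simp_all add: S_def w_def)
  ultimately have "S (Suc i) (Suc j) n = arr m (Suc i) (Suc j)"
    by (simp add: n w_def algebra_simps)
  then show ?case by (simp add: S_def w_def)
qed

lemma of_nat_mod_ring_eq_0_iff:
  "of_nat n = (0 :: 'p::prime_card mod_ring) \<longleftrightarrow> CARD('p) dvd n"
  by (simp add: of_nat_eq_0_iff_char_dvd)

text \<open>The prime divides every inner entry of its own row of Pascal's triangle, so Pascal's
  rule makes neighbours in the row before it negatives of each other.\<close>

lemma choose_card_minus_one_mod_ring:
  assumes "k < CARD('p::prime_card)"
  shows "of_nat ((CARD('p) - 1) choose k) = (-1 :: 'p mod_ring) ^ k"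
  using assms
proof (induction k)
  case (Suc k)
  have p: "prime CARD('p)" by (rule prime_card)
  then have "CARD('p) dvd (CARD('p) choose Suc k)"
    using Suc.prems by (intro dvd_choose_prime) auto
  moreover have "CARD('p) choose Suc k = ((CARD('p) - 1) choose k) + ((CARD('p) - 1) choose Suc k)"
    using binomial_Suc_Suc[of "CARD('p) - 1" k] by simp
  ultimately have "of_nat ((CARD('p) - 1) choose k) + of_nat ((CARD('p) - 1) choose Suc k) = (0 :: 'p mod_ring)"
    by (metis of_nat_add of_nat_mod_ring_eq_0_iff)
  then show ?case using Suc by (simp add: eq_neg_iff_add_eq_0 add.commute)
qed simp

lemma arr_last_row:
  fixes m :: "'p::prime_card mod_ring"
  assumes "j < CARD('p)"
  shows "arr m (CARD('p) - 1) j = (- m) ^ j"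
proof -
  \<comment> \<open>Transposing makes the sum stop at \<open>j\<close>, the range of the binomial
    expansion of \<open>(- (1 + m) + 1) ^ j\<close>.\<close>
  have "arr m (CARD('p) - 1) j = arr m j (CARD('p) - 1)" by (rule arr_sym)
  also have "\<dots> = (\<Sum>k\<le>j. of_nat (j choose k) * of_nat ((CARD('p) - 1) choose k) * (1 + m) ^ k)"
    by (rule arr_eq_sum_choose) simp
  also have "\<dots> = (\<Sum>k\<le>j. of_nat (j choose k) * (- (1 + m)) ^ k * 1 ^ (j - k))"
  proof (intro sum.cong refl)
    fix k assume "k \<in> {..j}"
    then have "k < CARD('p)" using assms by simp
    then show "of_nat (j choose k) * of_nat ((CARD('p) - 1) choose k) * (1 + m) ^ k
        = of_nat (j choose k) * (- (1 + m)) ^ k * 1 ^ (j - k)"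
      using power_mult_distrib[of "-1" "1 + m" k]
      by (simp only: choose_card_minus_one_mod_ring) (simp add: mult.assoc)
  qed
  also have "\<dots> = (- (1 + m) + 1) ^ j" by (rule binomial_ring[symmetric])
  finally show ?thesis by simp
qed

lemma fermat_mod_ring:
  fixes a :: "'p::prime_card mod_ring"
  assumes "a \<noteq> 0"
  shows "a ^ (CARD('p) - 1) = 1"
proof -
  have "2 \<le> CARD('p)" using prime_card by (rule prime_ge_2_nat)
  then have "a ^ (CARD('p) - 1) = a ^ (CARD('p) - 2) * a"
    by (metis Suc_1 Suc_diff_Suc Suc_le_eq power_Suc2)
  \<comment> \<open>The field inverse of a nonzero element is defined as its power with exponent
    \<open>CARD('p) - 2\<close>.\<close>
  also have "\<dots> = inverse a * a" using assms by (simp add: inverse_mod_ring_def)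
  finally show ?thesis using assms by simp
qed

text \<open>An analogue of Lucas' theorem. The product of coarse and local value satisfies the
  recurrence: inside a block by its second factor, across block boundaries by the powers of
  \<open>- m\<close> in the last row and column.\<close>

lemma arr_mult:
  fixes m :: "'p::prime_card mod_ring"
  assumes "r < CARD('p)" "s < CARD('p)"
  shows "arr m (CARD('p) * i + r) (CARD('p) * j + s) = arr m i j * arr m r s"
proof -
  define p where "p = CARD('p)"
  have p2: "2 \<le> p" unfolding p_def using prime_card by (rule prime_ge_2_nat)
  have row: "arr m (p - 1) t = (- m) ^ t" if "t < p" for t
    using arr_last_row[of t m] that by (simp add: p_def)
  have col: "arr m t (p - 1) = (- m) ^ t" if "t < p" for t
    using row[OF that] by (simp add: arr_sym)
  \<comment> \<open>The diagonal step from block to block again has weight \<open>m\<close>, so the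
    coarse array obeys the same recurrence.\<close>
  have mp: "m * (- m) ^ (p - 1) = m"
    using fermat_mod_ring[of "- m"] by (cases "m = 0") (auto simp: p_def)
  define B where "B x y = arr m (x div p) (y div p) * arr m (x mod p) (y mod p)" for x y
  have Suc_cases: "(Suc x mod p = 0 \<and> Suc x div p = Suc (x div p) \<and> x mod p = p - 1)
      \<or> (Suc x mod p = Suc (x mod p) \<and> Suc x div p = x div p \<and> Suc (x mod p) < p)" for x
    using p2 by (auto simp: mod_Suc div_Suc) (metis Suc_lessI mod_less_divisor gr0I not_numeral_le_zero)
  have B0: "B 0 y = 1" "B y 0 = 1" for y by (simp_all add: B_def)
  have BSuc: "B (Suc x) (Suc y) = B x (Suc y) + m * B x y + B (Suc x) y" for x y
  proof -
    consider (a) "Suc x mod p = 0" "Suc x div p = Suc (x div p)" "x mod p = p - 1"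
        "Suc y mod p = 0" "Suc y div p = Suc (y div p)" "y mod p = p - 1"
      | (b) "Suc x mod p = 0" "Suc x div p = Suc (x div p)" "x mod p = p - 1"
        "Suc y mod p = Suc (y mod p)" "Suc y div p = y div p" "Suc (y mod p) < p"
      | (c) "Suc x mod p = Suc (x mod p)" "Suc x div p = x div p" "Suc (x mod p) < p"
        "Suc y mod p = 0" "Suc y div p = Suc (y div p)" "y mod p = p - 1"
      | (d) "Suc x mod p = Suc (x mod p)" "Suc x div p = x div p"
        "Suc y mod p = Suc (y mod p)" "Suc y div p = y div p"
      using Suc_cases[of x] Suc_cases[of y] by (elim disjE conjE) (use that in blast)+
    then show ?thesis
    proof cases
      case a
      have "B x y = arr m (x div p) (y div p) * (- m) ^ (p - 1)"
        using row[of "p - 1"] p2 by (simp add: B_def a)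
      then have "m * B x y = m * arr m (x div p) (y div p)"
        using mp by (metis mult.assoc mult.commute)
      then show ?thesis by (simp add: B_def a del: arr.simps) (simp add: algebra_simps)
    next
      case b
      \<comment> \<open>Only the row index enters a new block: the two terms in the last row of the
        old block cancel, and the two in row 0 of the new block agree.\<close>
      have "(- m) ^ Suc (y mod p) + m * (- m) ^ (y mod p) = 0" by simp
      then have "arr m (x div p) (y div p) * (- m) ^ Suc (y mod p)
          + m * (arr m (x div p) (y div p) * (- m) ^ (y mod p)) = 0"
        by (metis mult.left_commute distrib_left mult_zero_right)
      then show ?thesis using b row[of "Suc (y mod p)"] row[of "y mod p", OF Suc_lessD]
        by (simp only: B_def b) simp
    next
      case c
      have "(- m) ^ Suc (x mod p) + m * (- m) ^ (x mod p) = 0" by simp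
      then have "arr m (x div p) (y div p) * (- m) ^ Suc (x mod p)
          + m * (arr m (x div p) (y div p) * (- m) ^ (x mod p)) = 0"
        by (metis mult.left_commute distrib_left mult_zero_right)
      then show ?thesis using c col[of "Suc (x mod p)"] col[of "x mod p", OF Suc_lessD]
        by (simp only: B_def c) (simp add: algebra_simps)
    next
      case d
      then show ?thesis by (simp add: B_def algebra_simps)
    qed
  qed
  have "arr m x y = B x y" for x y
    by (rule arr_eqI[where n = "Suc (x + y)"]) (simp_all add: B0 BSuc)
  from this[of "p * i + r" "p * j + s"] show ?thesis
    using assms p2 by (simp add: B_def p_def[symmetric] del: arr.simps)
qed

lemma arr_mult_power:
  fixes m :: "'p::prime_card mod_ring"
  assumes "r < CARD('p) ^ d" "s < CARD('p) ^ d"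
  shows "arr m (CARD('p) ^ d * i + r) (CARD('p) ^ d * j + s) = arr m i j * arr m r s"
  using assms
proof (induction d arbitrary: r s)
  case (Suc d)
  let ?p = "CARD('p)"
  have "r div ?p < ?p ^ d" "s div ?p < ?p ^ d"
    using Suc.prems by (simp_all add: div_less_iff_less_mult mult.commute)
  note IH = Suc.IH[OF this]
  have split: "?p ^ Suc d * x + y = ?p * (?p ^ d * x + y div ?p) + y mod ?p" for x y
    by (simp add: algebra_simps)
  have "arr m (?p ^ Suc d * i + r) (?p ^ Suc d * j + s)
      = arr m (?p ^ d * i + r div ?p) (?p ^ d * j + s div ?p) * arr m (r mod ?p) (s mod ?p)"
    unfolding split by (rule arr_mult) simp_all
  also have "\<dots> = arr m i j * (arr m (r div ?p) (s div ?p) * arr m (r mod ?p) (s mod ?p))"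
    by (simp add: IH mult.assoc)
  also have "arr m (r div ?p) (s div ?p) * arr m (r mod ?p) (s mod ?p) = arr m r s"
    using arr_mult[of "r mod ?p" "s mod ?p" m "r div ?p" "s div ?p"] by simp
  finally show ?case .
qed simp

lemma arr_rotate:
  fixes m :: "'p::prime_card mod_ring"
  assumes "m \<noteq> 0" "i < CARD('p)" "j < CARD('p)"
  shows "arr m i j = (- m) ^ (i + j) * arr m (CARD('p) - 1 - i) (CARD('p) - 1 - j)"
proof -
  define p where "p = CARD('p)"
  have fermat: "(- m) ^ (p - 1) = 1" using fermat_mod_ring[of "- m"] assms by (simp add: p_def)
  \<comment> \<open>Reversal turns the first row and column into the last ones, where the exponents
    add up to \<open>p - 1\<close>.\<close>
  have row: "(- m) ^ t * arr m (p - 1) (p - 1 - t) = 1" if "t < p" for t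
  proof -
    have "arr m (p - 1) (p - 1 - t) = (- m) ^ (p - 1 - t)"
      using arr_last_row[of "p - 1 - t" m] that unfolding p_def by auto
    then have "(- m) ^ t * arr m (p - 1) (p - 1 - t) = (- m) ^ (t + (p - 1 - t))"
      by (simp only: power_add)
    also have "t + (p - 1 - t) = p - 1" using that by simp
    finally show ?thesis using fermat by simp
  qed
  show ?thesis unfolding p_def[symmetric]
  proof (rule arr_eqI[where n = p])
    show "(- m) ^ (0 + t) * arr m (p - 1 - 0) (p - 1 - t) = 1" if "t < p" for t
      using row[OF that] by simp
    show "(- m) ^ (t + 0) * arr m (p - 1 - t) (p - 1 - 0) = 1" if "t < p" for t
      using row[OF that] by (simp add: arr_sym)
    show "(- m) ^ (Suc a + Suc b) * arr m (p - 1 - Suc a) (p - 1 - Suc b)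
        = (- m) ^ (a + Suc b) * arr m (p - 1 - a) (p - 1 - Suc b)
        + m * ((- m) ^ (a + b) * arr m (p - 1 - a) (p - 1 - b))
        + (- m) ^ (Suc a + b) * arr m (p - 1 - Suc a) (p - 1 - b)"
      if "Suc a < p" "Suc b < p" for a b
    proof -
      \<comment> \<open>The recurrence at the reversed position, multiplied by
        \<open>m * (- m) ^ (a + b)\<close>, is the required identity: reversal exchanges the first
        and the last of the four entries.\<close>
      have "p - 1 - a = Suc (p - 1 - Suc a)" "p - 1 - b = Suc (p - 1 - Suc b)" using that by simp_all
      then show ?thesis by (simp only: arr.simps) (simp add: algebra_simps)
    qed
  qed (use assms in \<open>auto simp: p_def\<close>)
qed

lemma arr_one_reflect:
  assumes "i < CARD('p)" "j < CARD('p)"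
  shows "arr (1 :: 'p::prime_card mod_ring) i j = (- 1) ^ i * arr 1 i (CARD('p) - 1 - j)"
proof -
  define p where "p = CARD('p)"
  define m :: "'p mod_ring" where "m = 1"
  have "arr m i j = (- 1) ^ i * arr m i (p - 1 - j)"
  proof (rule arr_eqI[where n = p])
    show "(- 1) ^ 0 * arr m 0 (p - 1 - t) = 1" if "t < p" for t by simp
    show "(- 1) ^ t * arr m t (p - 1 - 0) = 1" if "t < p" for t
    proof -
      have "arr m t (p - 1) = (- 1) ^ t"
        using arr_last_row[of t m] arr_sym[of m t "p - 1"] that by (simp add: p_def m_def)
      then show ?thesis by (simp add: power_mult_distrib[symmetric])
    qed
    show "(- 1) ^ Suc a * arr m (Suc a) (p - 1 - Suc b)
        = (- 1) ^ a * arr m a (p - 1 - Suc b)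
        + m * ((- 1) ^ a * arr m a (p - 1 - b))
        + (- 1) ^ Suc a * arr m (Suc a) (p - 1 - b)"
      if "Suc a < p" "Suc b < p" for a b
    proof -
      have "p - 1 - b = Suc (p - 1 - Suc b)" using that by simp
      then show ?thesis by (simp only: arr.simps) (simp add: algebra_simps m_def)
    qed
  qed (use assms in \<open>auto simp: p_def\<close>)
  then show ?thesis by (simp add: m_def p_def)
qed

section \<open>The zero pattern in base-p digits\<close>

lemma arr_eq_0_rec:
  fixes m :: "'p::prime_card mod_ring"
  shows "arr m i j = 0 \<longleftrightarrow>
    arr m (i div CARD('p)) (j div CARD('p)) = 0 \<or> arr m (i mod CARD('p)) (j mod CARD('p)) = 0"
  using arr_mult[of "i mod CARD('p)" "j mod CARD('p)" m "i div CARD('p)" "j div CARD('p)"] by simp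

text \<open>Both digits of \<open>n * q - 1\<close>, the quotient \<open>q - 1\<close> and the
  remainder \<open>n - 1\<close>, are maximal, so the subtraction never borrows and reversal acts on
  each digit separately.\<close>

lemma reverse_div_mod:
  fixes n q i :: nat
  assumes "i < n * q"
  shows "(n * q - 1 - i) div n = q - 1 - i div n" "(n * q - 1 - i) mod n = n - 1 - i mod n"
proof -
  have "n > 0" using assms by (cases n) auto
  have "i div n < q" using assms by (simp add: div_less_iff_less_mult mult.commute \<open>n > 0\<close>)
  then obtain k where k: "q = Suc (i div n + k)" by (auto dest: less_imp_Suc_add)
  have "n * q = n * (i div n) + n + n * k" by (simp add: k algebra_simps)
  moreover have "i mod n < n" using \<open>n > 0\<close> by simp
  moreover have "n * (i div n) + i mod n = i" by simp
  ultimately have "n * q - 1 - i = n * k + (n - 1 - i mod n)" by linarith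
  then have "n * q - 1 - i = n * (q - 1 - i div n) + (n - 1 - i mod n)" by (simp add: k)
  then show "(n * q - 1 - i) div n = q - 1 - i div n" "(n * q - 1 - i) mod n = n - 1 - i mod n"
    using \<open>n > 0\<close> by simp_all
qed

text \<open>The factor \<open>(- m) ^ (i + j)\<close> in \<open>arr_rotate\<close> is nonzero, so
  the identity for one block carries the zero pattern over digit by digit.\<close>

lemma arr_eq_0_rotate:
  fixes m :: "'p::prime_card mod_ring"
  assumes "m \<noteq> 0" "i < CARD('p) ^ d" "j < CARD('p) ^ d"
  shows "arr m (CARD('p) ^ d - 1 - i) (CARD('p) ^ d - 1 - j) = 0 \<longleftrightarrow> arr m i j = 0"
  using assms(2,3)
proof (induction d arbitrary: i j)
  case (Suc d)
  let ?p = "CARD('p)"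
  have "i div ?p < ?p ^ d" "j div ?p < ?p ^ d"
    using Suc.prems by (simp_all add: div_less_iff_less_mult mult.commute)
  note IH = Suc.IH[OF this]
  have "arr m (?p - 1 - i mod ?p) (?p - 1 - j mod ?p) = 0 \<longleftrightarrow> arr m (i mod ?p) (j mod ?p) = 0"
    using arr_rotate[of m "i mod ?p" "j mod ?p"] assms(1) by auto
  then show ?case
    using Suc.prems IH reverse_div_mod[of i ?p "?p ^ d"] reverse_div_mod[of j ?p "?p ^ d"]
    by (subst (1 2) arr_eq_0_rec) (simp only: power_Suc)
qed simp

lemma arr_one_eq_0_reflect:
  assumes "i < CARD('p) ^ d" "j < CARD('p) ^ d"
  shows "arr (1 :: 'p::prime_card mod_ring) i (CARD('p) ^ d - 1 - j) = 0 \<longleftrightarrow> arr (1 :: 'p mod_ring) i j = 0"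
  using assms
proof (induction d arbitrary: i j)
  case (Suc d)
  let ?p = "CARD('p)" and ?m = "1 :: 'p mod_ring"
  have "i div ?p < ?p ^ d" "j div ?p < ?p ^ d"
    using Suc.prems by (simp_all add: div_less_iff_less_mult mult.commute)
  note IH = Suc.IH[OF this]
  have "arr ?m (i mod ?p) (?p - 1 - j mod ?p) = 0 \<longleftrightarrow> arr ?m (i mod ?p) (j mod ?p) = 0"
    using arr_one_reflect[of "i mod ?p" "j mod ?p", where 'p = 'p] by auto
  then show ?case
    using Suc.prems IH reverse_div_mod[of j ?p "?p ^ d"]
    by (subst (1 2) arr_eq_0_rec) (simp only: power_Suc)
qed simp

lemma arr_first_row: "arr m 1 j = 1 + of_nat j * (1 + m)"
  by (induction j) (auto simp: algebra_simps)

lemma arr_0_eq_choose: "arr 0 i j = of_nat ((i + j) choose i)"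
  by (rule arr_eqI[where n = "Suc (i + j)"]) (simp_all add: add.commute)

lemma arr_minus_one: "arr (- 1) i j = 1"
  by (rule arr_eqI[where n = "Suc (i + j)"]) simp_all

section \<open>The limit of the images\<close>

lemma bdd_above_infdist_image:
  fixes A B :: "'a::metric_space set"
  assumes "bounded A" "B \<noteq> {}"
  shows "bdd_above ((\<lambda>x. infdist x B) ` A)"
proof -
  obtain b where b: "b \<in> B" using assms(2) by blast
  obtain e where e: "\<And>x. x \<in> A \<Longrightarrow> dist b x \<le> e"
    using bounded_any_center[THEN iffD1, OF assms(1), of b] by auto
  have "infdist x B \<le> e" if "x \<in> A" for x
    using infdist_le[OF b, of x] e[OF that] by (simp add: dist_commute)
  then show ?thesis by (intro bdd_aboveI2)
qed

text \<open>A real \<open>SUP\<close> is sure to bound its elements only when they are bounded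
  above, hence the boundedness hypotheses.\<close>

lemma infdist_le_hausdorff_dist:
  assumes "bounded A" "bounded B" "A \<noteq> {}" "B \<noteq> {}"
  shows "x \<in> A \<Longrightarrow> infdist x B \<le> hausdorff_dist A B" "y \<in> B \<Longrightarrow> infdist y A \<le> hausdorff_dist A B"
  unfolding hausdorff_dist_def
  using cSUP_upper[OF _ bdd_above_infdist_image[OF assms(1,4)]] cSUP_upper[OF _ bdd_above_infdist_image[OF assms(2,3)]]
  by (auto intro: le_max_iff_disj[THEN iffD2])

lemma hausdorff_dist_leI:
  assumes "A \<noteq> {}" "B \<noteq> {}"
    and "\<And>x. x \<in> A \<Longrightarrow> \<exists>y\<in>B. dist x y \<le> e" "\<And>y. y \<in> B \<Longrightarrow> \<exists>x\<in>A. dist x y \<le> e"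
  shows "hausdorff_dist A B \<le> e"
  unfolding hausdorff_dist_def
proof (intro max.boundedI cSUP_least)
  show "infdist x B \<le> e" if "x \<in> A" for x
    using assms(3)[OF that] infdist_le order_trans by metis
  show "infdist y A \<le> e" if "y \<in> B" for y
    using assms(4)[OF that] infdist_le[of _ A y] order_trans by (metis dist_commute)
qed (use assms in auto)

text \<open>Passing through a point of \<open>X d\<close> bounds \<open>infdist x L\<close> by a sum
  of two Hausdorff distances that tends to 0, and \<open>L\<close> is closed.\<close>

lemma hausdorff_limit_subset:
  assumes K: "hausdorff_limit X K" and L: "hausdorff_limit X L"
  shows "K \<subseteq> L"
proof
  fix x assume x: "x \<in> K"
  note K = K[unfolded hausdorff_limit_def] and L = L[unfolded hausdorff_limit_def]
  have "infdist x L \<le> hausdorff_dist (X d) K + hausdorff_dist (X d) L" for d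
  proof -
    have "infdist x L \<le> dist x y + infdist y L" for y
      using infdist_triangle[of x L y] by (simp add: add.commute)
    moreover have "infdist y L \<le> hausdorff_dist (X d) L" if "y \<in> X d" for y
      using K L that by (intro infdist_le_hausdorff_dist compact_imp_bounded) auto
    ultimately have "infdist x L - hausdorff_dist (X d) L \<le> dist x y" if "y \<in> X d" for y
      using that by (smt (verit))
    then have "infdist x L - hausdorff_dist (X d) L \<le> infdist x (X d)"
      using K unfolding infdist_def[of x "X d"] by (auto intro!: cINF_greatest)
    also have "\<dots> \<le> hausdorff_dist (X d) K"
      using K x by (intro infdist_le_hausdorff_dist compact_imp_bounded) auto
    finally show ?thesis by simp
  qed
  moreover have "(\<lambda>d. hausdorff_dist (X d) K + hausdorff_dist (X d) L) \<longlonglongrightarrow> 0"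
    using tendsto_add[of "\<lambda>d. hausdorff_dist (X d) K" 0 sequentially "\<lambda>d. hausdorff_dist (X d) L" 0] K L by simp
  ultimately have "infdist x L \<le> 0"
    by (intro LIMSEQ_le_const) auto
  then have "infdist x L = 0" using infdist_nonneg[of x L] by simp
  then show "x \<in> L" using L in_closed_iff_infdist_zero[of L x] compact_imp_closed by auto
qed

lemma hausdorff_limit_unique:
  "hausdorff_limit X K \<Longrightarrow> hausdorff_limit X L \<Longrightarrow> K = L"
  using hausdorff_limit_subset by blast

section \<open>Cells of the grid\<close>

lemma mem_cell_iff:
  assumes "0 < n"
  shows "(x, y) \<in> cell n i j \<longleftrightarrow>
    real i \<le> n * x \<and> n * x \<le> real i + 1 \<and> real j \<le> n * y \<and> n * y \<le> real j + 1"
  using assms by (auto simp: cell_def field_simps)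

lemma cell_corner: "0 < n \<Longrightarrow> (real i / n, real j / n) \<in> cell n i j"
  by (simp add: mem_cell_iff)

lemma compact_cell: "compact (cell n i j)"
  unfolding cell_def by (intro compact_Times) auto

lemma cell_subset_unit_square:
  assumes "i < n" "j < n"
  shows "cell n i j \<subseteq> unit_square"
proof
  fix z assume z: "z \<in> cell n i j"
  obtain x y where xy: "z = (x, y)" by fastforce
  have "real i + 1 \<le> n" "real j + 1 \<le> n" using assms by linarith+
  moreover have "real i \<le> n * x" "n * x \<le> real i + 1" "real j \<le> n * y" "n * y \<le> real j + 1"
    using z assms unfolding xy by (simp_all add: mem_cell_iff)
  ultimately have "0 \<le> n * x" "n * x \<le> n * 1" "0 \<le> n * y" "n * y \<le> n * 1" by linarith+
  then show "z \<in> unit_square"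
    using assms unfolding xy unit_square_def by (simp add: zero_le_mult_iff mult_le_cancel_left_pos)
qed

text \<open>The sum norm gives the constant 2 instead of the diameter constant
  \<open>sqrt 2\<close>; for the limit only the decay in \<open>n\<close> matters.\<close>

lemma dist_cell_le:
  assumes "0 < n" "x \<in> cell n i j" "y \<in> cell n i j"
  shows "dist x y \<le> 2 / n"
proof -
  obtain x1 x2 y1 y2 where xy: "x = (x1, x2)" "y = (y1, y2)" by fastforce
  have "\<bar>x1 - y1\<bar> \<le> 1 / n" "\<bar>x2 - y2\<bar> \<le> 1 / n"
    using assms unfolding xy by (auto simp: cell_def field_simps abs_le_iff)
  moreover have "dist x y \<le> \<bar>x1 - y1\<bar> + \<bar>x2 - y2\<bar>"
    unfolding xy dist_Pair_Pair by (simp add: dist_real_def sqrt_sum_squares_le_sum_abs)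
  ultimately show ?thesis by simp
qed

lemma cell_refine:
  assumes "0 < n" "0 < k"
  shows "cell (n * k) i j \<subseteq> cell n (i div k) (j div k)"
proof
  fix z assume z: "z \<in> cell (n * k) i j"
  obtain x y where [simp]: "z = (x, y)" by fastforce
  have *: "real (i div k) \<le> n * x \<and> n * x \<le> real (i div k) + 1"
    if "real i \<le> real (n * k) * x" "real (n * k) * x \<le> real i + 1" for i and x :: real
  proof -
    have "k * (i div k) + i mod k = i" by simp
    moreover have "i mod k < k" using assms by simp
    \<comment> \<open>Integrality sharpens \<open>i mod k < k\<close> to the bound on
      \<open>i + 1\<close>, which keeps the far edge of the small cell inside the large one.\<close>
    ultimately have "k * (i div k) \<le> i" "i + 1 \<le> k * (i div k + 1)"
      by (simp_all only: distrib_left mult_1_right)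
    then have "real k * real (i div k) \<le> real i" "real i + 1 \<le> real k * (real (i div k) + 1)"
      by (metis of_nat_le_iff of_nat_mult, metis of_nat_le_iff of_nat_mult of_nat_add of_nat_1)
    with that have "real k * real (i div k) \<le> real k * (n * x)" "real k * (n * x) \<le> real k * (real (i div k) + 1)"
      by (simp_all add: mult_ac)
    then show ?thesis using assms by simp
  qed
  show "z \<in> cell n (i div k) (j div k)"
    using z assms *[of i x] *[of j y] by (simp add: mem_cell_iff)
qed

section \<open>Nested images and their intersection\<close>

lemma mem_bw_image_M_mat:
  fixes m :: "'p::prime_card mod_ring"
  shows "z \<in> bw_image (M_mat m d) \<longleftrightarrow>
    (\<exists>i<CARD('p) ^ d. \<exists>j<CARD('p) ^ d. arr m i j \<noteq> 0 \<and> z \<in> cell (CARD('p) ^ d) i j)"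
proof -
  have "bw_image (M_mat m d) = (\<Union>i<CARD('p) ^ d. \<Union>j\<in>{j. j < CARD('p) ^ d \<and> arr m i j \<noteq> 0}.
      cell (CARD('p) ^ d) i j)"
    unfolding bw_image_def by (intro SUP_cong) (auto simp: M_mat_def)
  then show ?thesis by blast
qed

lemma compact_bw_image: "compact (bw_image A)"
  unfolding bw_image_def by (intro compact_UN) (auto intro: compact_cell)

lemma bw_image_M_mat_subset_unit_square:
  fixes m :: "'p::prime_card mod_ring"
  shows "bw_image (M_mat m d) \<subseteq> unit_square"
  using cell_subset_unit_square by (fastforce simp: mem_bw_image_M_mat)

text \<open>Dropping the last base-p digit of both indices leads from a nonzero entry to a nonzero
  entry, whose cell contains the finer one.\<close>

lemma decseq_bw_image_M_mat:
  fixes m :: "'p::prime_card mod_ring"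
  shows "decseq (\<lambda>d. bw_image (M_mat m d))"
proof (rule decseq_SucI, rule subsetI)
  let ?p = "CARD('p)"
  fix d z assume "z \<in> bw_image (M_mat m (Suc d))"
  then obtain i j where ij: "i < ?p ^ d * ?p" "j < ?p ^ d * ?p" "arr m i j \<noteq> 0" "z \<in> cell (?p ^ d * ?p) i j"
    by (auto simp: mem_bw_image_M_mat mult.commute)
  have "i div ?p < ?p ^ d" "j div ?p < ?p ^ d"
    using ij by (simp_all add: div_less_iff_less_mult)
  moreover have "arr m (i div ?p) (j div ?p) \<noteq> 0" using ij arr_eq_0_rec[of m i j] by blast
  moreover have "z \<in> cell (?p ^ d) (i div ?p) (j div ?p)"
    using cell_refine[of "?p ^ d" ?p i j] ij by auto
  ultimately show "z \<in> bw_image (M_mat m d)" by (auto simp: mem_bw_image_M_mat)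
qed

text \<open>Since \<open>arr m 0 0 = 1\<close>, the corner of a nonzero cell belongs to a nonzero cell of every finer level.\<close>

lemma corner_mem_bw_image_M_mat:
  fixes m :: "'p::prime_card mod_ring"
  assumes "i < CARD('p) ^ d" "j < CARD('p) ^ d" "arr m i j \<noteq> 0"
  shows "(real i / real (CARD('p) ^ d), real j / real (CARD('p) ^ d)) \<in> bw_image (M_mat m e)"
proof -
  let ?p = "CARD('p)"
  have fine: "(real i / real (?p ^ d), real j / real (?p ^ d)) \<in> bw_image (M_mat m (d + k))" for k
  proof -
    have "arr m (?p ^ k * i) (?p ^ k * j) = arr m i j"
      using arr_mult_power[of 0 k 0 m i j] by simp
    moreover have "?p ^ k * i < ?p ^ (d + k)" "?p ^ k * j < ?p ^ (d + k)"
      using assms by (simp_all add: power_add mult.commute)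
    moreover have "(real i / real (?p ^ d), real j / real (?p ^ d)) \<in> cell (?p ^ (d + k)) (?p ^ k * i) (?p ^ k * j)"
      using cell_corner[of "?p ^ (d + k)" "?p ^ k * i" "?p ^ k * j"] by (simp add: power_add)
    ultimately show ?thesis using assms unfolding mem_bw_image_M_mat by metis
  qed
  show ?thesis
  proof (cases "d \<le> e")
    case True
    then show ?thesis using fine[of "e - d"] by simp
  next
    case False
    then show ?thesis using fine[of 0] decseqD[OF decseq_bw_image_M_mat[of m], of e d] by auto
  qed
qed

text \<open>Each point of the level \<open>d\<close> image shares a nonzero cell with the corner of
  that cell, and this corner survives on all levels. The other half of the distance is trivial by
  inclusion.\<close>

lemma hausdorff_limit_Inter:
  fixes m :: "'p::prime_card mod_ring"
  shows "hausdorff_limit (\<lambda>d. bw_image (M_mat m d)) (\<Inter>d. bw_image (M_mat m d))"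
proof -
  let ?p = "CARD('p)" and ?X = "\<lambda>d. bw_image (M_mat m d)"
  let ?K = "\<Inter>d. ?X d"
  have "(0, 0) \<in> ?K" using corner_mem_bw_image_M_mat[of 0 0 0 m] by simp
  then have ne: "?K \<noteq> {}" "?X d \<noteq> {}" for d by blast+
  have p2: "2 \<le> ?p" using prime_card by (rule prime_ge_2_nat)
  have le: "hausdorff_dist (?X d) ?K \<le> 2 * (1 / ?p) ^ d" for d
  proof (rule hausdorff_dist_leI)
    fix x assume "x \<in> ?X d"
    then obtain i j where ij: "i < ?p ^ d" "j < ?p ^ d" "arr m i j \<noteq> 0" "x \<in> cell (?p ^ d) i j"
      by (auto simp: mem_bw_image_M_mat)
    let ?y = "(real i / real (?p ^ d), real j / real (?p ^ d))"
    have "dist x ?y \<le> 2 / real (?p ^ d)"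
      using ij by (intro dist_cell_le[of _ _ i j] cell_corner) auto
    moreover have "?y \<in> ?K" using corner_mem_bw_image_M_mat[OF ij(1-3)] by blast
    ultimately show "\<exists>y\<in>?K. dist x y \<le> 2 * (1 / ?p) ^ d"
      by (intro bexI[of _ ?y]) (simp_all add: power_one_over)
  next
    fix y assume "y \<in> ?K"
    then show "\<exists>x\<in>?X d. dist x y \<le> 2 * (1 / ?p) ^ d" by (auto intro!: bexI[of _ y])
  qed (use ne in auto)
  \<comment> \<open>The lower bound for the sandwich argument is read off at the common point
    \<open>(0, 0)\<close>.\<close>
  have nonneg: "0 \<le> hausdorff_dist (?X d) ?K" for d
  proof -
    have "infdist (0, 0) ?K \<le> hausdorff_dist (?X d) ?K"
      using ne \<open>(0, 0) \<in> ?K\<close> compact_imp_bounded[OF compact_bw_image[of "M_mat m d"]]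
      by (intro infdist_le_hausdorff_dist(1)) (auto intro: bounded_subset)
    then show ?thesis using infdist_nonneg[of "(0, 0)" ?K] by linarith
  qed
  have "(\<lambda>d. 2 * (1 / real ?p) ^ d) \<longlonglongrightarrow> 2 * 0"
    using p2 by (intro tendsto_mult_left LIMSEQ_realpow_zero) auto
  then have "(\<lambda>d. hausdorff_dist (?X d) ?K) \<longlonglongrightarrow> 0"
    using tendsto_sandwich[OF always_eventually[OF allI[OF nonneg]] always_eventually[OF allI[OF le]]
        tendsto_const, of "\<lambda>d. d" sequentially] by simp
  moreover have "compact ?K" using compact_bw_image by (intro compact_Inter) auto
  ultimately show ?thesis using ne compact_bw_image by (auto simp: hausdorff_limit_def)
qed

lemma limit_image_eq_Inter: "limit_image m = (\<Inter>d. bw_image (M_mat m d))"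
  unfolding limit_image_def using hausdorff_limit_Inter
  by (rule the_equality) (rule hausdorff_limit_unique[OF _ hausdorff_limit_Inter])

lemma limit_image_subset_unit_square: "limit_image m \<subseteq> unit_square"
  unfolding limit_image_eq_Inter using bw_image_M_mat_subset_unit_square by blast

lemma corner_mem_limit_image:
  fixes m :: "'p::prime_card mod_ring"
  assumes "i < CARD('p) ^ d" "j < CARD('p) ^ d" "arr m i j \<noteq> 0"
  shows "(real i / real (CARD('p) ^ d), real j / real (CARD('p) ^ d)) \<in> limit_image m"
  unfolding limit_image_eq_Inter using corner_mem_bw_image_M_mat[OF assms] by blast

text \<open>A point in the interior of a cell of level 1 lies in no other cell of that level.\<close>

lemma limit_image_interior_cell:
  fixes m :: "'p::prime_card mod_ring" and x y :: real
  assumes "(x, y) \<in> limit_image m"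
    and "real i < CARD('p) * x" "CARD('p) * x < real i + 1" "real j < CARD('p) * y" "CARD('p) * y < real j + 1"
  shows "arr m i j \<noteq> 0"
proof -
  have "(x, y) \<in> bw_image (M_mat m 1)" using assms(1) by (auto simp: limit_image_eq_Inter)
  then obtain i' j' where ij: "arr m i' j' \<noteq> 0" "(x, y) \<in> cell CARD('p) i' j'"
    by (auto simp: mem_bw_image_M_mat)
  have "i' = i" "j' = j" using assms(2-) ij(2) by (simp_all add: mem_cell_iff)
  then show ?thesis using ij by simp
qed

text \<open>Maps that preserve every level preserve the intersection, and the right inverse
  \<open>g\<close> makes \<open>f\<close> onto.\<close>

lemma limit_image_image_eqI:
  assumes "\<And>d z. z \<in> bw_image (M_mat m d) \<Longrightarrow> f z \<in> bw_image (M_mat m d)"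
    and "\<And>d z. z \<in> bw_image (M_mat m d) \<Longrightarrow> g z \<in> bw_image (M_mat m d)"
    and "\<And>z. z \<in> unit_square \<Longrightarrow> f (g z) = z"
  shows "f ` limit_image m = limit_image m"
proof -
  have "f z \<in> limit_image m" "g z \<in> limit_image m" if "z \<in> limit_image m" for z
    using that assms(1,2) by (auto simp: limit_image_eq_Inter)
  moreover have "f (g z) = z" if "z \<in> limit_image m" for z
    using assms(3) limit_image_subset_unit_square that by blast
  ultimately show ?thesis by (auto simp: image_iff) metis
qed

section \<open>Symmetries of the finite images\<close>

lemma mem_cell_reverse:
  fixes x :: real
  assumes "i < n"
  shows "real (n - 1 - i) \<le> n * (1 - x) \<and> n * (1 - x) \<le> real (n - 1 - i) + 1 \<longleftrightarrow> real i \<le> n * x \<and> n * x \<le> real i + 1"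
  using assms by (auto simp: of_nat_diff algebra_simps)

lemma bw_image_M_mat_transpose:
  assumes "(x, y) \<in> bw_image (M_mat m d)"
  shows "(y, x) \<in> bw_image (M_mat m d)"
proof -
  have "(x, y) \<in> cell n i j \<Longrightarrow> (y, x) \<in> cell n j i" for n i j by (simp add: cell_def)
  then show ?thesis using assms arr_sym[of m] unfolding mem_bw_image_M_mat by metis
qed

lemma bw_image_M_mat_rotate:
  fixes m :: "'p::prime_card mod_ring"
  assumes "(x, y) \<in> bw_image (M_mat m d)" "m \<noteq> 0"
  shows "(1 - x, 1 - y) \<in> bw_image (M_mat m d)"
proof -
  let ?q = "CARD('p) ^ d"
  obtain i j where ij: "i < ?q" "j < ?q" "arr m i j \<noteq> 0" "(x, y) \<in> cell ?q i j"
    using assms by (auto simp: mem_bw_image_M_mat)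
  have "(1 - x, 1 - y) \<in> cell ?q (?q - 1 - i) (?q - 1 - j)"
    using ij mem_cell_reverse[OF ij(1), of x] mem_cell_reverse[OF ij(2), of y] unfolding mem_cell_iff[OF zero_less_power[OF zero_less_card_finite]] by blast
  moreover have "arr m (?q - 1 - i) (?q - 1 - j) \<noteq> 0"
    using arr_eq_0_rotate[OF assms(2) ij(1,2)] ij(3) by simp
  moreover have "?q - 1 - i < ?q" "?q - 1 - j < ?q" using ij by auto
  ultimately show ?thesis unfolding mem_bw_image_M_mat by blast
qed

lemma bw_image_M_mat_reflect:
  assumes "(x, y) \<in> bw_image (M_mat (1 :: 'p::prime_card mod_ring) d)"
  shows "(x, 1 - y) \<in> bw_image (M_mat (1 :: 'p mod_ring) d)"
proof -
  let ?q = "CARD('p) ^ d" and ?m = "1 :: 'p mod_ring"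
  obtain i j where ij: "i < ?q" "j < ?q" "arr ?m i j \<noteq> 0" "(x, y) \<in> cell ?q i j"
    using assms by (auto simp: mem_bw_image_M_mat)
  have "(x, 1 - y) \<in> cell ?q i (?q - 1 - j)"
    using ij mem_cell_reverse[OF ij(2), of y] unfolding mem_cell_iff[OF zero_less_power[OF zero_less_card_finite]] by blast
  moreover have "arr ?m i (?q - 1 - j) \<noteq> 0"
    using arr_one_eq_0_reflect[OF ij(1,2)] ij(3) by simp
  moreover have "?q - 1 - j < ?q" using ij by auto
  ultimately show ?thesis using ij(1) unfolding mem_bw_image_M_mat by blast
qed

section \<open>Isometries of the square\<close>

text \<open>The boolean \<open>t\<close> tells whether the coordinates are swapped first; \<open>a\<close> and \<open>b\<close> tell which of the
  resulting coordinates are reflected.\<close>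

definition sq_sym :: "bool \<Rightarrow> bool \<Rightarrow> bool \<Rightarrow> real \<times> real \<Rightarrow> real \<times> real" where
  "sq_sym t a b = (\<lambda>(x, y)\<in>unit_square.
     (if a then 1 - (if t then y else x) else (if t then y else x),
      if b then 1 - (if t then x else y) else (if t then x else y)))"

lemma sq_sym_apply:
  assumes "(x, y) \<in> unit_square"
  shows "sq_sym t a b (x, y) =
     (if a then 1 - (if t then y else x) else (if t then y else x),
      if b then 1 - (if t then x else y) else (if t then x else y))"
  using assms by (simp add: sq_sym_def)

lemma sq_sym_mem: "z \<in> unit_square \<Longrightarrow> sq_sym t a b z \<in> unit_square"
  by (cases z; cases t; cases a; cases b) (simp_all add: sq_sym_apply unit_square_def)

text \<open>The outer swap exchanges the inner reflection flags before they meet the outer ones;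
  inequality of booleans serves as exclusive or.\<close>

lemma sq_sym_sq_sym:
  assumes "z \<in> unit_square"
  shows "sq_sym t a b (sq_sym t' a' b' z)
    = sq_sym (t \<noteq> t') (a \<noteq> (if t then b' else a')) (b \<noteq> (if t then a' else b')) z"
proof -
  obtain x y where z: "z = (x, y)" by fastforce
  have "(x, y) \<in> unit_square" using assms z by simp
  note apply_inner = sq_sym_apply[OF this]
  show ?thesis
    using sq_sym_apply[OF sq_sym_mem[OF assms, of t' a' b', unfolded z apply_inner], of t a b]
    by (simp add: z apply_inner)
qed

text \<open>Conjugation with the swap exchanges the two coordinate reflections, so the flags trade
  places when \<open>t\<close> holds.\<close>

lemma sq_sym_inverse:
  assumes "z \<in> unit_square"
  shows "sq_sym t a b (sq_sym t (if t then b else a) (if t then a else b) z) = z"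
  using assms by (subst sq_sym_sq_sym) (auto simp: sq_sym_apply sq_sym_def)

lemma compose_sq_sym:
  "compose unit_square (sq_sym t a b) (sq_sym t' a' b')
    = sq_sym (t \<noteq> t') (a \<noteq> (if t then b' else a')) (b \<noteq> (if t then a' else b'))"
proof
  fix z
  show "compose unit_square (sq_sym t a b) (sq_sym t' a' b') z
    = sq_sym (t \<noteq> t') (a \<noteq> (if t then b' else a')) (b \<noteq> (if t then a' else b')) z"
  proof (cases "z \<in> unit_square")
    case True
    then show ?thesis by (simp add: compose_eq sq_sym_sq_sym)
  next
    case False
    then show ?thesis by (simp add: compose_def sq_sym_def)
  qed
qed

lemma corners_mem_unit_square [simp]:
  "(0, 0) \<in> unit_square" "(0, 1) \<in> unit_square" "(1, 0) \<in> unit_square" "(1, 1) \<in> unit_square"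
  by (auto simp: unit_square_def)

lemma sq_sym_eq_iff: "sq_sym t a b = sq_sym t' a' b' \<longleftrightarrow> t = t' \<and> a = a' \<and> b = b'"
proof
  assume eq: "sq_sym t a b = sq_sym t' a' b'"
  have "sq_sym t a b (0, 0) = sq_sym t' a' b' (0, 0)" "sq_sym t a b (0, 1) = sq_sym t' a' b' (0, 1)"
    by (simp_all only: eq)
  then show "t = t' \<and> a = a' \<and> b = b'"
    by (auto simp: sq_sym_apply split: if_splits)
qed auto

lemma sq_sym_mem_square_isometries: "sq_sym t a b \<in> square_isometries"
proof -
  let ?f = "sq_sym t a b" and ?g = "sq_sym t (if t then b else a) (if t then a else b)"
  have "bij_betw ?f unit_square unit_square"
  proof (rule bij_betwI[where g = ?g])
    show "?g (?f z) = z" if "z \<in> unit_square" for z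
      using that sq_sym_inverse[of z t "if t then b else a" "if t then a else b"]
      by (cases t) auto
  qed (auto simp: sq_sym_mem sq_sym_inverse)
  then have "?f \<in> Bij unit_square" by (simp add: Bij_def sq_sym_def)
  moreover have "dist (?f z) (?f w) = dist z w" if "z \<in> unit_square" "w \<in> unit_square" for z w
  proof -
    obtain x y x' y' where zw: "z = (x, y)" "w = (x', y')" by fastforce
    have "dist (1 - s) (1 - t) = dist s t" for s t :: real by (simp add: dist_real_def abs_minus_commute)
    then show ?thesis using that unfolding zw by (auto simp: sq_sym_apply dist_Pair_Pair add.commute)
  qed
  ultimately show ?thesis by (simp add: square_isometries_def)
qed

text \<open>Each squared coordinate difference is at most 1, so a sum of 2 forces both to be
  extremal.\<close>

lemma opposite_corners:
  assumes "(x, y) \<in> unit_square" "(x', y') \<in> unit_square" "dist (x, y) (x', y') = sqrt 2"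
  shows "x \<in> {0, 1} \<and> y \<in> {0, 1} \<and> x' = 1 - x \<and> y' = 1 - y"
proof -
  have ge: "0 \<le> x" "x \<le> 1" "0 \<le> y" "y \<le> 1" "0 \<le> x'" "x' \<le> 1" "0 \<le> y'" "y' \<le> 1"
    using assms by (auto simp: unit_square_def)
  have "(x - x')\<^sup>2 + (y - y')\<^sup>2 = 2" using assms(3) by (simp add: dist_Pair_Pair dist_real_def)
  moreover have "(x - x')\<^sup>2 \<le> 1" "(y - y')\<^sup>2 \<le> 1" using ge by (auto simp: abs_square_le_1 abs_le_iff)
  ultimately have "(x - x')\<^sup>2 = 1" "(y - y')\<^sup>2 = 1" by auto
  then have "x - x' = 1 \<or> x - x' = -1" "y - y' = 1 \<or> y - y' = -1" by (auto simp: power2_eq_1_iff)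
  then show ?thesis using ge by auto
qed

text \<open>Diagonals go to diagonals because they realize the diameter. The corner images then fix
  the flags, and the distances to the corners determine every other point.\<close>

lemma square_isometry_eq_sq_sym:
  assumes "f \<in> square_isometries"
  shows "\<exists>t a b. f = sq_sym t a b"
proof -
  have Bij: "f \<in> Bij unit_square" and iso: "\<And>z w. z \<in> unit_square \<Longrightarrow> w \<in> unit_square \<Longrightarrow> dist (f z) (f w) = dist z w"
    using assms by (auto simp: square_isometries_def)
  have f_mem: "f z \<in> unit_square" if "z \<in> unit_square" for z
    using Bij_imp_funcset[OF Bij] that by auto
  obtain al be where c00: "f (0, 0) = (al, be)" by fastforce
  obtain ga de where c01: "f (0, 1) = (ga, de)" by fastforce
  obtain al' be' where c11': "f (1, 1) = (al', be')" by fastforce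
  obtain ga' de' where c10': "f (1, 0) = (ga', de')" by fastforce
  have ab: "al \<in> {0, 1}" "be \<in> {0, 1}" and c11: "f (1, 1) = (1 - al, 1 - be)"
    using opposite_corners[of al be al' be'] f_mem[of "(0, 0)"] f_mem[of "(1, 1)"] iso[of "(0, 0)" "(1, 1)"]
    by (auto simp: c00 c11' dist_Pair_Pair)
  have cd: "ga \<in> {0, 1}" "de \<in> {0, 1}" and c10: "f (1, 0) = (1 - ga, 1 - de)"
    using opposite_corners[of ga de ga' de'] f_mem[of "(0, 1)"] f_mem[of "(1, 0)"] iso[of "(0, 1)" "(1, 0)"]
    by (auto simp: c01 c10' dist_Pair_Pair)
  have sq: "(u - u')\<^sup>2 + (v - v')\<^sup>2 = (x - x')\<^sup>2 + (y - y')\<^sup>2"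
    if "f (x, y) = (u, v)" "f (x', y') = (u', v')" "(x, y) \<in> unit_square" "(x', y') \<in> unit_square" for x y x' y' u v u' v'
    using iso[OF that(3,4)] by (simp add: that(1,2) dist_Pair_Pair dist_real_def)
  have "(al - ga)\<^sup>2 + (be - de)\<^sup>2 = 1" using sq[OF c00 c01] by simp
  then have adj: "(ga = al \<and> de = 1 - be) \<or> (ga = 1 - al \<and> de = be)"
    using ab cd by auto
  \<comment> \<open>The image of the edge from \<open>(0, 0)\<close> to \<open>(0, 1)\<close> runs
    along the first coordinate exactly when the coordinates are swapped.\<close>
  define t where "t \<longleftrightarrow> ga \<noteq> al"
  have "f z = sq_sym t (al = 1) (be = 1) z" for z
  proof (cases "z \<in> unit_square")
    case True
    obtain x y u v where z: "z = (x, y)" and fz: "f (x, y) = (u, v)" by (metis prod.exhaust)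
    have mem: "(x, y) \<in> unit_square" using True z by simp
    \<comment> \<open>Differences of these four quadratic equations are linear in \<open>u\<close>
      and \<open>v\<close>.\<close>
    note e = sq[OF fz c00 mem] sq[OF fz c01 mem] sq[OF fz c10 mem] sq[OF fz c11 mem]
    show ?thesis
      using ab adj e unfolding z fz sq_sym_apply[OF mem] t_def
      by (auto simp: power2_eq_square algebra_simps)
  next
    case False
    then show ?thesis using extensional_arb[OF Bij_imp_extensional[OF Bij]] by (simp add: sq_sym_def)
  qed
  then show ?thesis by blast
qed

lemma square_isometries_eq: "square_isometries = (\<lambda>(t, a, b). sq_sym t a b) ` UNIV"
  using square_isometry_eq_sq_sym sq_sym_mem_square_isometries by (fastforce simp: image_iff)

lemma card_square_isometries: "card square_isometries = 8"
proof -
  have "inj (\<lambda>(t, a, b). sq_sym t a b)" by (auto intro!: injI simp: sq_sym_eq_iff)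
  then have "card square_isometries = card (UNIV :: (bool \<times> bool \<times> bool) set)"
    unfolding square_isometries_eq by (rule card_image)
  also have "\<dots> = 8" by (simp add: card_prod)
  finally show ?thesis .
qed

section \<open>The dihedral group and its subgroups\<close>

lemma carrier_dihedral_square [simp]: "carrier dihedral_square = square_isometries"
  by (simp add: dihedral_square_def)

lemma one_dihedral_square: "\<one>\<^bsub>dihedral_square\<^esub> = sq_sym False False False"
  by (auto simp: dihedral_square_def BijGroup_def sq_sym_def intro!: restrict_ext)

lemma mult_dihedral_square:
  assumes "f \<in> square_isometries" "g \<in> square_isometries"
  shows "f \<otimes>\<^bsub>dihedral_square\<^esub> g = compose unit_square f g"
  using assms by (simp add: dihedral_square_def BijGroup_def square_isometries_def)

lemma mult_sq_sym:
  "sq_sym t a b \<otimes>\<^bsub>dihedral_square\<^esub> sq_sym t' a' b'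
    = sq_sym (t \<noteq> t') (a \<noteq> (if t then b' else a')) (b \<noteq> (if t then a' else b'))"
  by (simp only: mult_dihedral_square sq_sym_mem_square_isometries compose_sq_sym)

lemma refl_diag1_eq_sq_sym: "refl_diag1 = sq_sym True False False"
  by (simp add: refl_diag1_def sq_sym_def)

lemma refl_diag2_eq_sq_sym: "refl_diag2 = sq_sym True True True"
  by (simp add: refl_diag2_def sq_sym_def)

lemma group_dihedral_square: "group dihedral_square"
proof (rule groupI)
  show "\<exists>g\<in>carrier dihedral_square. g \<otimes>\<^bsub>dihedral_square\<^esub> f = \<one>\<^bsub>dihedral_square\<^esub>"
    if f: "f \<in> carrier dihedral_square" for f
  proof -
    obtain t a b where f: "f = sq_sym t a b" using square_isometry_eq_sq_sym[of f] f by auto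
    show ?thesis
      by (rule bexI[of _ "sq_sym t (if t then b else a) (if t then a else b)"])
        (auto simp: f mult_sq_sym one_dihedral_square sq_sym_eq_iff sq_sym_mem_square_isometries)
  qed
  show "f \<otimes>\<^bsub>dihedral_square\<^esub> g \<otimes>\<^bsub>dihedral_square\<^esub> h = f \<otimes>\<^bsub>dihedral_square\<^esub> (g \<otimes>\<^bsub>dihedral_square\<^esub> h)"
    if "f \<in> carrier dihedral_square" "g \<in> carrier dihedral_square" "h \<in> carrier dihedral_square" for f g h
    using that by (auto simp: square_isometries_eq mult_sq_sym sq_sym_eq_iff)
qed (auto simp: square_isometries_eq mult_sq_sym one_dihedral_square sq_sym_eq_iff image_iff)

lemma carrier_symmetry_group: "carrier (symmetry_group K) = {f \<in> square_isometries. f ` K = K}"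
  by (simp add: symmetry_group_def)

text \<open>Composition and identity of the group are restricted to the square; as \<open>K\<close>
  lies inside it, they act on \<open>K\<close> like the unrestricted ones.\<close>

lemma subgroup_symmetry_group:
  assumes "K \<subseteq> unit_square"
  shows "subgroup (carrier (symmetry_group K)) dihedral_square"
proof -
  interpret group dihedral_square by (rule group_dihedral_square)
  have image: "(f \<otimes>\<^bsub>dihedral_square\<^esub> g) ` K = f ` g ` K"
    if "f \<in> square_isometries" "g \<in> square_isometries" for f g
    using assms that by (force simp: mult_dihedral_square compose_def image_iff)
  have one: "\<one>\<^bsub>dihedral_square\<^esub> ` K = K"
    using assms by (force simp: dihedral_square_def BijGroup_def)
  show ?thesis unfolding carrier_symmetry_group
  proof (rule subgroupI)
    show "{f \<in> square_isometries. f ` K = K} \<noteq> {}" using one one_closed by auto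
    show "inv\<^bsub>dihedral_square\<^esub> f \<in> {f \<in> square_isometries. f ` K = K}"
      if f: "f \<in> {f \<in> square_isometries. f ` K = K}" for f
    proof -
      have "inv\<^bsub>dihedral_square\<^esub> f \<in> square_isometries" using f inv_closed[of f] by simp
      moreover have "(inv\<^bsub>dihedral_square\<^esub> f \<otimes>\<^bsub>dihedral_square\<^esub> f) ` K = K"
        using f one by simp
      ultimately show ?thesis using f image[of "inv\<^bsub>dihedral_square\<^esub> f" f] by simp
    qed
    show "f \<otimes>\<^bsub>dihedral_square\<^esub> g \<in> {f \<in> square_isometries. f ` K = K}"
      if "f \<in> {f \<in> square_isometries. f ` K = K}" "g \<in> {f \<in> square_isometries. f ` K = K}" for f g
      using that m_closed[of f g] image[of f g] by simp
  qed auto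
qed

lemma group_symmetry_group:
  assumes "K \<subseteq> unit_square"
  shows "group (symmetry_group K)"
proof -
  have "symmetry_group K = dihedral_square\<lparr>carrier := carrier (symmetry_group K)\<rparr>"
    by (simp add: symmetry_group_def)
  then show ?thesis
    using group.subgroup_imp_group[OF group_dihedral_square subgroup_symmetry_group[OF assms]] by metis
qed

lemma mult_symmetry_group: "monoid.mult (symmetry_group K) = monoid.mult dihedral_square"
  by (simp add: symmetry_group_def)

lemma one_symmetry_group: "\<one>\<^bsub>symmetry_group K\<^esub> = \<one>\<^bsub>dihedral_square\<^esub>"
  by (simp add: symmetry_group_def)

section \<open>Identification with the symmetric group on two points and Klein's group\<close>

lemma (in group) square_eq_one_of_carrier_pair:
  assumes "carrier G = {\<one>, r}"
  shows "r \<otimes> r = \<one>"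
  using assms m_closed[of r r] l_cancel_one[of r r] by auto

lemma groups_of_order_two_iso:
  assumes G: "group G" "carrier G = {\<one>\<^bsub>G\<^esub>, r}" "r \<noteq> \<one>\<^bsub>G\<^esub>"
    and H: "group H" "carrier H = {\<one>\<^bsub>H\<^esub>, s}" "s \<noteq> \<one>\<^bsub>H\<^esub>"
  shows "G \<cong> H"
proof -
  interpret G: group G by (rule G)
  interpret H: group H by (rule H)
  have "r \<otimes>\<^bsub>G\<^esub> r = \<one>\<^bsub>G\<^esub>" "s \<otimes>\<^bsub>H\<^esub> s = \<one>\<^bsub>H\<^esub>"
    using G.square_eq_one_of_carrier_pair G H.square_eq_one_of_carrier_pair H by auto
  moreover have "r \<in> carrier G" "s \<in> carrier H" using G H by auto
  ultimately have "(\<lambda>x. if x = r then s else \<one>\<^bsub>H\<^esub>) \<in> iso G H"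
    using G H by (auto simp: iso_def hom_def bij_betw_def inj_on_def)
  then show ?thesis by (auto simp: is_iso_def)
qed

lemma carrier_sym_group_2: "carrier (sym_group 2) = {id, Transposition.transpose 1 2}"
proof -
  have "{1..2::nat} = {1, 2}" by auto
  then show ?thesis
    using permutes_doubleton_iff[of _ "1 :: nat" 2] by (auto simp: sym_group_carrier set_eq_iff[of "carrier (sym_group 2)"])
qed

lemma group_klein_four: "group klein_four"
  unfolding klein_four_def by (intro DirProd_group group_integer_mod_group)

text \<open>The first residue records the swap, the second the half-turn. Equal flags are unaffected
  by a swap, so composition is addition modulo 2 in each component.\<close>

lemma klein_four_iso:
  assumes "K \<subseteq> unit_square" "carrier (symmetry_group K) = {sq_sym t a a | t a. True}"
  shows "symmetry_group K \<cong> klein_four"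
proof -
  let ?h = "\<lambda>(i, j). sq_sym (i = 1) (j = 1) (j = 1 :: bool)"
  have carrier: "carrier klein_four = {(0, 0), (0, 1), (1, 0), (1, 1)}"
    by (auto simp: klein_four_def DirProd_def carrier_integer_mod_group)
  have "?h \<in> iso klein_four (symmetry_group K)"
    unfolding iso_def
  proof (intro CollectI conjI)
    show "?h \<in> hom klein_four (symmetry_group K)"
      unfolding hom_def carrier assms(2) mult_symmetry_group
      by (auto simp: klein_four_def DirProd_def mult_sq_sym sq_sym_eq_iff)
    show "bij_betw ?h (carrier klein_four) (carrier (symmetry_group K))"
      unfolding bij_betw_def carrier assms(2) 
      by (auto simp: inj_on_def sq_sym_eq_iff)
  qed
  then show ?thesis
    using group.iso_sym[OF group_klein_four] by (auto simp: is_iso_def)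
qed

lemma generate_refl_diag:
  "generate dihedral_square {refl_diag1, refl_diag2} = {sq_sym t a a | t a. True}"
proof
  interpret group dihedral_square by (rule group_dihedral_square)
  let ?S = "generate dihedral_square {refl_diag1, refl_diag2}"
  show "?S \<subseteq> {sq_sym t a a | t a. True}"
  proof
    fix f assume "f \<in> ?S"
    then show "f \<in> {sq_sym t a a | t a. True}"
    proof induction
      case one
      then show ?case by (auto simp: one_dihedral_square)
    next
      case (incl h)
      then show ?case by (auto simp: refl_diag1_eq_sq_sym refl_diag2_eq_sq_sym)
    next
      case (inv h)
      have "h \<otimes>\<^bsub>dihedral_square\<^esub> h = \<one>\<^bsub>dihedral_square\<^esub>" "h \<in> carrier dihedral_square"
        using inv by (auto simp: refl_diag1_eq_sq_sym refl_diag2_eq_sq_sym mult_sq_sym one_dihedral_square sq_sym_mem_square_isometries)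
      then have "inv\<^bsub>dihedral_square\<^esub> h = h" by (simp add: inv_equality)
      then show ?case using inv by (auto simp: refl_diag1_eq_sq_sym refl_diag2_eq_sq_sym)
    next
      case (eng h1 h2)
      then show ?case by (auto simp: mult_sq_sym sq_sym_eq_iff)
    qed
  qed
  have r: "sq_sym True False False \<in> ?S" "sq_sym True True True \<in> ?S"
    by (auto intro: generate.incl simp: refl_diag1_eq_sq_sym refl_diag2_eq_sq_sym)
  moreover have "sq_sym False False False \<in> ?S"
    using generate.one[of dihedral_square] by (simp add: one_dihedral_square)
  \<comment> \<open>The product of the two diagonal reflections is the half-turn.\<close>
  moreover have "sq_sym False True True \<in> ?S" using generate.eng[OF r] by (simp add: mult_sq_sym)
  ultimately have "sq_sym t a a \<in> ?S" for t a by (cases t; cases a) auto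
  then show "{sq_sym t a a | t a. True} \<subseteq> ?S" by auto
qed

section \<open>Self-similarity and symmetries of the limit\<close>

text \<open>The entry types of \<open>A\<close> and \<open>B\<close> may differ, so matrices over
  the finite field can be compared with matrices of natural numbers.\<close>

lemma bw_image_cong:
  assumes "dim_row A = dim_row B" "dim_col A = dim_col B"
    and "\<And>i j. i < dim_row B \<Longrightarrow> j < dim_col B \<Longrightarrow> A $$ (i, j) = 0 \<longleftrightarrow> B $$ (i, j) = 0"
  shows "bw_image A = bw_image B"
  unfolding bw_image_def assms(1,2) by (intro SUP_cong) (auto simp: assms(3))

text \<open>A tensor power splits off the most significant digit, and \<open>arr_mult_power\<close>
  factors the array in the same way; neither ring has zero divisors.\<close>

lemma tensor_power_zero_pattern:
  fixes m :: "'p::prime_card mod_ring"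
  defines "T \<equiv> tensor_power (zero_pattern (M_mat m 1))"
  shows "dim_row (T d) = CARD('p) ^ d \<and> dim_col (T d) = CARD('p) ^ d \<and>
    (\<forall>i<CARD('p) ^ d. \<forall>j<CARD('p) ^ d. T d $$ (i, j) = 0 \<longleftrightarrow> arr m i j = 0)"
proof (induction d)
  case 0
  then show ?case by (simp add: T_def)
next
  case (Suc d)
  let ?p = "CARD('p)"
  define D where "D = zero_pattern (M_mat m 1)"
  have D: "dim_row D = ?p" "dim_col D = ?p" by (simp_all add: D_def zero_pattern_def M_mat_def)
  have T: "T (Suc d) = tensor_mat D (T d)" by (simp add: T_def D_def)
  have "T (Suc d) $$ (i, j) = 0 \<longleftrightarrow> arr m i j = 0" if ij: "i < ?p * ?p ^ d" "j < ?p * ?p ^ d" for i j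
  proof -
    let ?q = "?p ^ d"
    have lt: "i div ?q < ?p" "j div ?q < ?p"
      using ij by (simp_all add: div_less_iff_less_mult)
    have "T (Suc d) $$ (i, j) = D $$ (i div ?q, j div ?q) * T d $$ (i mod ?q, j mod ?q)"
      using Suc ij by (simp add: T tensor_mat_def D)
    moreover have "D $$ (i div ?q, j div ?q) = 0 \<longleftrightarrow> arr m (i div ?q) (j div ?q) = 0"
      using lt by (simp add: D_def zero_pattern_def M_mat_def)
    moreover have "T d $$ (i mod ?q, j mod ?q) = 0 \<longleftrightarrow> arr m (i mod ?q) (j mod ?q) = 0"
      using Suc by simp
    moreover have "arr m i j = arr m (i div ?q) (j div ?q) * arr m (i mod ?q) (j mod ?q)"
      using arr_mult_power[of "i mod ?q" d "j mod ?q" m "i div ?q" "j div ?q"] by simp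
    ultimately show ?thesis by simp
  qed
  then show ?case using Suc by (simp add: T tensor_mat_def D)
qed

text \<open>Row 1 is an arithmetic progression with difference \<open>1 + m\<close>, here
  invertible; its zero \<open>- 1 / (1 + m)\<close> has a representative below p.\<close>

lemma exists_zero_in_first_row:
  fixes m :: "'p::prime_card mod_ring"
  assumes "m \<noteq> - 1"
  shows "\<exists>j<CARD('p). arr m 1 j = 0"
proof -
  obtain j where j: "j < CARD('p)" "- 1 / (1 + m) = of_nat j"
    using surj_of_nat_mod_ring by metis
  have "1 + m \<noteq> 0" using assms by (metis add.commute eq_neg_iff_add_eq_0)
  then have "arr m 1 j = 0" by (simp only: arr_first_row j(2)[symmetric]) simp
  then show ?thesis using j by blast
qed

lemma self_similar_limit_image:
  fixes m :: "'p::prime_card mod_ring"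
  assumes "m \<noteq> - 1"
  shows "self_similar_from (zero_pattern (M_mat m 1)) (limit_image m)"
proof -
  let ?p = "CARD('p)"
  define D where "D = zero_pattern (M_mat m 1)"
  have p2: "2 \<le> ?p" using prime_card by (rule prime_ge_2_nat)
  have dim: "dim_row D = ?p" "dim_col D = ?p" "\<And>i j. i < ?p \<Longrightarrow> j < ?p \<Longrightarrow> D $$ (i, j) = (if arr m i j = 0 then 0 else 1)"
    by (simp_all add: D_def zero_pattern_def M_mat_def)
  have fin: "finite {(i, j). i < ?p \<and> j < ?p \<and> P i j}" for P :: "nat \<Rightarrow> nat \<Rightarrow> bool"
    by (rule finite_subset[of _ "{..<?p} \<times> {..<?p}"]) auto
  obtain j where "j < ?p" "arr m 1 j = 0" using exists_zero_in_first_row[OF assms] by blast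
  \<comment> \<open>The zero in row 1 and the first two ones of row 0 meet the bounds of
    \<open>nontrivial_generator\<close>.\<close>
  then have "card {(1::nat, j)} \<le> card {(i, j). i < ?p \<and> j < ?p \<and> D $$ (i, j) = 0}"
    using p2 fin dim by (intro card_mono) auto
  moreover have "card {(0::nat, 0::nat), (0, 1)} \<le> card {(i, j). i < ?p \<and> j < ?p \<and> D $$ (i, j) = 1}"
    using p2 fin dim by (intro card_mono) auto
  ultimately have "nontrivial_generator D"
    by (simp add: nontrivial_generator_def dim)
  moreover have "bw_image (tensor_power D d) = bw_image (M_mat m d)" for d
    using tensor_power_zero_pattern[of m d] by (intro bw_image_cong) (auto simp: M_mat_def D_def)
  ultimately show ?thesis
    using hausdorff_limit_Inter[of m] by (simp add: self_similar_from_def limit_image_eq_Inter D_def)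
qed

lemma self_similar_pascal_triangle_limit_image:
  "self_similar_pascal_triangle CARD('p) (limit_image (0 :: 'p::prime_card mod_ring))"
proof -
  let ?p = "CARD('p)" and ?m = "0 :: 'p mod_ring"
  have zero: "((i + j) choose i) mod ?p = 0 \<longleftrightarrow> arr ?m i j = 0" for i j
    by (simp add: arr_0_eq_choose of_nat_mod_ring_eq_0_iff mod_eq_0_iff_dvd)
  have "bw_image (pascal_mat ?p (?p ^ d)) = bw_image (M_mat ?m d)" for d
    using zero by (intro bw_image_cong) (simp_all add: pascal_mat_def M_mat_def)
  moreover have "zero_pattern (pascal_mat ?p ?p) = zero_pattern (M_mat ?m 1)"
    using zero by (intro eq_matI) (simp_all add: zero_pattern_def pascal_mat_def M_mat_def)
  ultimately show ?thesis
    using self_similar_limit_image[of ?m] hausdorff_limit_Inter[of ?m]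
    by (simp add: self_similar_pascal_triangle_def limit_image_eq_Inter)
qed

lemma limit_image_minus_one: "limit_image (- 1) = unit_square"
proof -
  have "unit_square \<subseteq> bw_image (M_mat (- 1 :: 'p::prime_card mod_ring) d)" for d
  proof
    let ?q = "CARD('p) ^ d"
    fix z :: "real \<times> real" assume z: "z \<in> unit_square"
    obtain x y where xy: "z = (x, y)" by fastforce
    have q: "0 < ?q" by simp
    have ex: "\<exists>i<n. real i \<le> n * x \<and> n * x \<le> real i + 1" if "0 \<le> x" "x \<le> 1" "0 < n" for n :: nat and x :: real
    \<comment> \<open>At \<open>x = 1\<close> the floor would give the index \<open>n\<close>, which
      is out of range; the last cell is taken instead.\<close>
    proof (cases "x = 1")
      case True
      then show ?thesis using \<open>0 < n\<close> by (intro exI[of _ "n - 1"]) (simp add: of_nat_diff)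
    next
      case False
      then have "n * x < n" "0 \<le> n * x" using that by auto
      moreover have "real (nat \<lfloor>n * x\<rfloor>) \<le> n * x" "n * x \<le> real (nat \<lfloor>n * x\<rfloor>) + 1"
        using \<open>0 \<le> n * x\<close> by linarith+
      ultimately show ?thesis by (intro exI[of _ "nat \<lfloor>n * x\<rfloor>"]) linarith
    qed
    show "z \<in> bw_image (M_mat (- 1 :: 'p mod_ring) d)"
      using ex[of x ?q] ex[of y ?q] z q unfolding mem_bw_image_M_mat xy mem_cell_iff[OF q] unit_square_def
      by (auto simp add: arr_minus_one simp del: of_nat_power)
  qed
  then show ?thesis
    using limit_image_subset_unit_square[of "- 1"] unfolding limit_image_eq_Inter by blast
qed

lemma limit_image_corner:
  fixes m :: "'p::prime_card mod_ring"
  shows "(0, 0) \<in> limit_image m" "(0, 1) \<in> limit_image m" "(1, 0) \<in> limit_image m"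
proof -
  show "(0, 0) \<in> limit_image m" using corner_mem_limit_image[of 0 0 0 m] by simp
  \<comment> \<open>As a far corner of its cell, this point is not covered by
    \<open>corner_mem_limit_image\<close>; it lies in the last cell of row 0 on every level.\<close>
  have "(0, 1) \<in> bw_image (M_mat m d)" for d
  proof -
    let ?q = "CARD('p) ^ d"
    have "(0, 1) \<in> cell ?q 0 (?q - 1)" by (simp add: mem_cell_iff of_nat_diff)
    then show ?thesis unfolding mem_bw_image_M_mat by (intro exI[of _ 0] exI[of _ "?q - 1"] conjI) auto
  qed
  then show "(0, 1) \<in> limit_image m" "(1, 0) \<in> limit_image m"
    using bw_image_M_mat_transpose unfolding limit_image_eq_Inter by blast+
qed

text \<open>The only cell of level 1 that contains the point is the last one, whose entry
  \<open>(- m) ^ (p - 1)\<close> vanishes for \<open>m = 0\<close>.\<close>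

lemma limit_image_0_corner: "(1, 1) \<notin> limit_image (0 :: 'p::prime_card mod_ring)"
proof
  let ?p = "CARD('p)" and ?m = "0 :: 'p mod_ring"
  have p2: "2 \<le> ?p" using prime_card by (rule prime_ge_2_nat)
  assume "(1, 1) \<in> limit_image ?m"
  then have "(1, 1) \<in> bw_image (M_mat ?m 1)" by (auto simp: limit_image_eq_Inter)
  then obtain i j where ij: "i < ?p" "j < ?p" "arr ?m i j \<noteq> 0" "(1, 1) \<in> cell ?p i j"
    by (auto simp: mem_bw_image_M_mat)
  then have "i = ?p - 1" "j = ?p - 1" by (auto simp: mem_cell_iff)
  then have "arr ?m i j = (- ?m) ^ (?p - 1)" using arr_last_row[OF ij(2), of ?m] by simp
  also have "\<dots> = 0" using p2 by simp
  finally show False using ij by simp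
qed

section \<open>Determination of the symmetry groups\<close>

lemma sq_sym_mem_bw_image:
  fixes m :: "'p::prime_card mod_ring"
  assumes "z \<in> bw_image (M_mat m d)"
    and "(\<not> a \<and> \<not> b) \<or> (m \<noteq> 0 \<and> a = b) \<or> m = 1"
  shows "sq_sym t a b z \<in> bw_image (M_mat m d)"
proof -
  obtain x y where z: "z = (x, y)" by fastforce
  let ?X = "bw_image (M_mat m d)"
  define u v where "u = (if t then y else x)" and "v = (if t then x else y)"
  have uv: "(u, v) \<in> ?X" using assms(1) bw_image_M_mat_transpose by (auto simp: z u_def v_def)
  have "(x, y) \<in> unit_square" using assms(1) bw_image_M_mat_subset_unit_square z by blast
  then have eq: "sq_sym t a b z = (if a then 1 - u else u, if b then 1 - v else v)"
    by (simp add: z sq_sym_apply u_def v_def)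
  consider "\<not> a \<and> \<not> b" | "m \<noteq> 0" "a" "b" | "m = 1" "a \<noteq> b" using assms(2) by (cases "m = 0") auto
  then show ?thesis
  proof cases
    case 1
    then show ?thesis using uv eq by simp
  next
    case 2
    then show ?thesis using bw_image_M_mat_rotate[OF uv] eq by simp
  next
    case 3
    \<comment> \<open>Transposition conjugates the reflection of the second coordinate into that of
      the first.\<close>
    have "(u, 1 - v) \<in> ?X" "(1 - u, v) \<in> ?X"
      using bw_image_M_mat_reflect uv bw_image_M_mat_transpose unfolding \<open>m = 1\<close> by metis+
    then show ?thesis using 3 eq by auto
  qed
qed

lemma sq_sym_limit_image:
  fixes m :: "'p::prime_card mod_ring"
  assumes "(\<not> a \<and> \<not> b) \<or> (m \<noteq> 0 \<and> a = b) \<or> m = 1"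
  shows "sq_sym t a b \<in> carrier (symmetry_group (limit_image m))"
proof -
  have "sq_sym t a b ` limit_image m = limit_image m"
    by (rule limit_image_image_eqI[where g = "sq_sym t (if t then b else a) (if t then a else b)"])
      (use assms in \<open>auto simp only: sq_sym_inverse intro!: sq_sym_mem_bw_image split: if_splits\<close>)
  then show ?thesis by (simp add: carrier_symmetry_group sq_sym_mem_square_isometries)
qed

lemma symmetry_group_limit_image_0:
  "carrier (symmetry_group (limit_image (0 :: 'p::prime_card mod_ring)))
    = {\<one>\<^bsub>dihedral_square\<^esub>, refl_diag1}"
proof
  let ?I = "limit_image (0 :: 'p mod_ring)"
  show "carrier (symmetry_group ?I) \<subseteq> {\<one>\<^bsub>dihedral_square\<^esub>, refl_diag1}"
  proof
    fix f assume f: "f \<in> carrier (symmetry_group ?I)"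
    then obtain t a b where eq: "f = sq_sym t a b"
      using square_isometry_eq_sq_sym[of f] by (auto simp: carrier_symmetry_group)
    have "f z \<noteq> (1, 1)" if "z \<in> ?I" for z
    proof -
      have "f ` ?I = ?I" using f by (simp add: carrier_symmetry_group)
      then have "f z \<in> ?I" using that by (metis imageI)
      then show ?thesis using limit_image_0_corner by metis
    qed
    \<comment> \<open>None of the other three corners is sent to \<open>(1, 1)\<close>, which
      excludes all flags except the trivial ones.\<close>
    from this[OF limit_image_corner(1)] this[OF limit_image_corner(2)] this[OF limit_image_corner(3)]
    have "\<not> a \<and> \<not> b"
      unfolding eq by (cases t; cases a; cases b) (simp_all add: sq_sym_apply)
    then show "f \<in> {\<one>\<^bsub>dihedral_square\<^esub>, refl_diag1}"
      by (cases t) (simp_all add: eq one_dihedral_square refl_diag1_eq_sq_sym)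
  qed
  show "{\<one>\<^bsub>dihedral_square\<^esub>, refl_diag1} \<subseteq> carrier (symmetry_group ?I)"
    by (simp add: one_dihedral_square refl_diag1_eq_sq_sym sq_sym_limit_image)
qed

text \<open>The reflection takes cell \<open>(1, j)\<close> of level 1 to cell
  \<open>(1, j0)\<close>, where the entry is 0. The entry at \<open>(1, j)\<close> is nonzero, so it
  suffices to find a point of the limit in the interior of that cell.\<close>

lemma reflection_not_symmetry:
  fixes m :: "'p::prime_card mod_ring"
  assumes "m \<notin> {- 1, 0, 1}"
  shows "sq_sym False False True \<notin> carrier (symmetry_group (limit_image m))"
proof
  define p where "p = CARD('p)"
  have p2: "2 \<le> p" unfolding p_def using prime_card by (rule prime_ge_2_nat)
  assume sym: "sq_sym False False True \<in> carrier (symmetry_group (limit_image m))"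
  obtain j0 where j0: "j0 < p" "arr m 1 j0 = 0" using exists_zero_in_first_row[of m] assms by (auto simp: p_def)
  define j where "j = p - 1 - j0"
  have "arr m 1 j \<noteq> 0"
  proof
    assume "arr m 1 j = 0"
    \<comment> \<open>As \<open>j + j0\<close> is -1 modulo p, the sum of the two entries is
      \<open>1 - m\<close>.\<close>
    then have "(1 + of_nat j * (1 + m)) + (1 + of_nat j0 * (1 + m)) = 0"
      using j0 by (simp add: arr_first_row[simplified])
    moreover have "of_nat (j + j0 + 1) = (0 :: 'p mod_ring)"
      unfolding of_nat_mod_ring_eq_0_iff using j0 by (simp add: j_def p_def)
    then have "of_nat j + of_nat j0 = (- 1 :: 'p mod_ring)"
      by (metis of_nat_add of_nat_1 eq_neg_iff_add_eq_0)
    ultimately have "1 + 1 - (1 + m) = 0"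
      by (metis (no_types, opaque_lifting) add.assoc add.left_commute distrib_right mult_minus1 diff_conv_add_uminus)
    then show False using assms by simp
  qed
  \<comment> \<open>The witness is the corner of the subcell \<open>(p - 1, 1)\<close> of cell
    \<open>(1, j)\<close>. Its local entry is \<open>- m\<close>, and as neither local index is 0
    the corner is interior.\<close>
  moreover have "arr m (p - 1) 1 \<noteq> 0" using arr_last_row[of 1 m] p2 assms by (simp add: p_def)
  ultimately have nz: "arr m (p * 1 + (p - 1)) (p * j + 1) \<noteq> 0"
    using arr_mult[of "p - 1" 1 m 1 j] p2 by (simp add: p_def)
  have j: "j < p" "real j0 = real p - 1 - real j" using j0 by (auto simp: j_def of_nat_diff)
  have lt: "p * 1 + (p - 1) < p ^ 2" "p * j + 1 < p ^ 2"
  proof -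
    have "p * 2 \<le> p * p" "p * Suc j \<le> p * p" using p2 j by (intro mult_left_mono; simp)+
    then show "p * 1 + (p - 1) < p ^ 2" "p * j + 1 < p ^ 2"
      using p2 unfolding power2_eq_square mult_Suc_right by linarith+
  qed
  define x y where "x = real (p * 1 + (p - 1)) / real (p ^ 2)" and "y = real (p * j + 1) / real (p ^ 2)"
  have mem: "(x, y) \<in> limit_image m"
    using corner_mem_limit_image[of "p * 1 + (p - 1)" 2 "p * j + 1" m] lt nz
    unfolding p_def[symmetric] x_def y_def by blast
  have "sq_sym False False True (x, y) \<in> limit_image m" using sym mem by (auto simp: carrier_symmetry_group)
  moreover have "(x, y) \<in> unit_square" using mem limit_image_subset_unit_square by blast
  ultimately have mem': "(x, 1 - y) \<in> limit_image m" by (simp add: sq_sym_apply)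
  have px: "p * x = 2 - 1 / p" and py: "p * y = j + 1 / p"
    using p2 by (simp_all add: x_def y_def field_simps power2_eq_square of_nat_diff)
  have "0 < 1 / real p" "1 / real p < 1" using p2 by auto
  then have "arr m 1 j0 \<noteq> 0"
    using limit_image_interior_cell[OF mem', of 1 j0] px py j by (simp add: p_def[symmetric] right_diff_distrib)
  then show False using j0 by simp
qed

lemma symmetry_group_limit_image_generic:
  fixes m :: "'p::prime_card mod_ring"
  assumes "m \<notin> {- 1, 0, 1}"
  shows "carrier (symmetry_group (limit_image m)) = {sq_sym t a a | t a. True}"
proof
  let ?S = "carrier (symmetry_group (limit_image m))"
  have sub: "subgroup ?S dihedral_square" by (rule subgroup_symmetry_group[OF limit_image_subset_unit_square])
  show "?S \<subseteq> {sq_sym t a a | t a. True}"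
  proof
    fix f assume f: "f \<in> ?S"
    then obtain t a b where eq: "f = sq_sym t a b"
      using square_isometry_eq_sq_sym[of f] by (auto simp: carrier_symmetry_group)
    have "a = b"
    proof (rule ccontr)
      assume "a \<noteq> b"
      \<comment> \<open>This choice cancels the swap and the reflection of the first coordinate, and
        leaves that of the second.\<close>
      let ?c = "if t then b else a"
      have "sq_sym t ?c ?c \<in> ?S" using assms by (intro sq_sym_limit_image) auto
      then have "sq_sym t ?c ?c \<otimes>\<^bsub>dihedral_square\<^esub> f \<in> ?S" using f by (intro subgroup.m_closed[OF sub])
      also have "sq_sym t ?c ?c \<otimes>\<^bsub>dihedral_square\<^esub> f = sq_sym False False True"
        using \<open>a \<noteq> b\<close> by (auto simp: eq mult_sq_sym sq_sym_eq_iff)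
      finally show False using reflection_not_symmetry[OF assms] by blast
    qed
    then show "f \<in> {sq_sym t a a | t a. True}" using eq by blast
  qed
  show "{sq_sym t a a | t a. True} \<subseteq> ?S" using assms by (auto intro!: sq_sym_limit_image)
qed

text \<open>The elements 0, 1 and \<open>m\<close> exclude p = 2, hence 1 and -1 differ and there
  are four distinct elements; 4 is not prime. This makes the three cases of the theorem
  exhaustive.\<close>

lemma card_ge_5_mod_ring:
  fixes m :: "'p::prime_card mod_ring"
  assumes "m \<notin> {- 1, 0, 1}"
  shows "CARD('p) \<ge> 5"
proof -
  let ?p = "CARD('p)"
  have le: "card A \<le> ?p" for A :: "'p mod_ring set" using card_mono[of UNIV A] by simp
  have "card {0, 1, m} = 3" using assms by auto
  then have p3: "3 \<le> ?p" using le[of "{0, 1, m}"] by simp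
  have "(1 :: 'p mod_ring) \<noteq> - 1"
  proof
    assume "(1 :: 'p mod_ring) = - 1"
    then have "of_nat 2 = (0 :: 'p mod_ring)" by (simp add: eq_neg_iff_add_eq_0)
    then have "?p dvd 2" by (simp only: of_nat_mod_ring_eq_0_iff)
    then show False using p3 by (auto dest: dvd_imp_le)
  qed
  then have "card {0, 1, - 1, m} = 4" using assms by auto
  then have "4 \<le> ?p" using le[of "{0, 1, - 1, m}"] by simp
  moreover have "?p \<noteq> 4" using prime_card[where 'a = 'p] by auto
  ultimately show ?thesis by simp
qed

theorem theorem5p1:
  fixes m :: "'p::prime_card mod_ring"
    and p :: nat
    and I :: "(real \<times> real) set"
    and G :: "(real \<times> real \<Rightarrow> real \<times> real) monoid"
  assumes "p = CARD('p)"
    and "I = limit_image m"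
    and "G = symmetry_group I"
  shows "hausdorff_limit (\<lambda>d. bw_image (M_mat m d)) I
    \<and> subgroup (carrier G) dihedral_square
    \<and> exactly_one (m = 0) (m = 1 \<or> m = -1) (p \<ge> 5 \<and> m \<notin> {-1, 0, 1})
    \<and> (m = 0 \<longrightarrow>
         self_similar_pascal_triangle p I
         \<and> carrier G = {\<one>\<^bsub>dihedral_square\<^esub>, refl_diag1}
         \<and> G \<cong> sym_group 2)
    \<and> (m = 1 \<or> m = -1 \<longrightarrow>
         (m = -1 \<longrightarrow> I = unit_square)
         \<and> (m = 1 \<and> m \<noteq> -1 \<longrightarrow> nontrivial_self_similar I)
         \<and> G = dihedral_square
         \<and> card (carrier G) = 8)
    \<and> (p \<ge> 5 \<and> m \<notin> {-1, 0, 1} \<longrightarrow>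
         nontrivial_self_similar I
         \<and> carrier G = generate dihedral_square {refl_diag1, refl_diag2}
         \<and> G \<cong> klein_four)"
proof (intro conjI impI)
  have sub: "I \<subseteq> unit_square" unfolding assms by (rule limit_image_subset_unit_square)
  show "hausdorff_limit (\<lambda>d. bw_image (M_mat m d)) I"
    using hausdorff_limit_Inter[of m] by (simp add: assms limit_image_eq_Inter)
  show "subgroup (carrier G) dihedral_square"
    unfolding \<open>G = symmetry_group I\<close> by (rule subgroup_symmetry_group[OF sub])
  show "exactly_one (m = 0) (m = 1 \<or> m = -1) (p \<ge> 5 \<and> m \<notin> {-1, 0, 1})"
    using card_ge_5_mod_ring[of m] assms(1) by (auto simp: exactly_one_def)
  show "self_similar_pascal_triangle p I" if "m = 0"
    using self_similar_pascal_triangle_limit_image by (simp add: assms that)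
  show carrier: "carrier G = {\<one>\<^bsub>dihedral_square\<^esub>, refl_diag1}" if "m = 0"
    using symmetry_group_limit_image_0 by (simp add: assms that)
  show "G \<cong> sym_group 2" if "m = 0"
  proof (rule groups_of_order_two_iso)
    show "group G" unfolding \<open>G = symmetry_group I\<close> by (rule group_symmetry_group[OF sub])
    show "carrier G = {\<one>\<^bsub>G\<^esub>, refl_diag1}" "refl_diag1 \<noteq> \<one>\<^bsub>G\<^esub>"
      using carrier[OF that]
      by (simp_all add: assms(3) one_symmetry_group one_dihedral_square refl_diag1_eq_sq_sym sq_sym_eq_iff)
    show "carrier (sym_group 2) = {\<one>\<^bsub>sym_group 2\<^esub>, Transposition.transpose 1 2}"
      by (simp add: carrier_sym_group_2 sym_group_one)
    show "Transposition.transpose 1 2 \<noteq> \<one>\<^bsub>sym_group 2\<^esub>"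
      by (auto simp: sym_group_one dest: fun_cong[of _ _ "1 :: nat"])
  qed (rule sym_group_is_group)
  show "I = unit_square" if "m = - 1"
    by (simp add: assms that limit_image_minus_one)
  \<comment> \<open>For p = 2 the elements 1 and -1 coincide and \<open>I\<close> is the full
    square, hence the second condition.\<close>
  show "nontrivial_self_similar I" if "m = 1 \<and> m \<noteq> - 1"
    using self_similar_limit_image[of m] that by (auto simp: assms nontrivial_self_similar_def)
  have full: "carrier G = square_isometries" if "m = 1 \<or> m = - 1"
  proof -
    have "f \<in> carrier G" if "f \<in> square_isometries" for f
    proof (cases "m = 1")
      case True
      then show ?thesis
        using square_isometry_eq_sq_sym[OF that] sq_sym_limit_image[of _ _ m] by (auto simp: assms)
    next
      case False
      then have "I = unit_square" using \<open>m = 1 \<or> m = - 1\<close> by (simp add: assms limit_image_minus_one)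
      moreover have "f ` unit_square = unit_square"
        using that by (auto simp: square_isometries_def Bij_def bij_betw_def)
      ultimately show ?thesis using that by (simp add: assms(3) carrier_symmetry_group)
    qed
    then show ?thesis by (auto simp: assms(3) carrier_symmetry_group)
  qed
  show "G = dihedral_square" if "m = 1 \<or> m = - 1"
    using full[OF that] unfolding assms(3) carrier_symmetry_group
    by (simp add: symmetry_group_def dihedral_square_def)
  show "card (carrier G) = 8" if "m = 1 \<or> m = - 1"
    by (simp add: full[OF that] card_square_isometries)
  assume m: "p \<ge> 5 \<and> m \<notin> {-1, 0, 1}"
  show "nontrivial_self_similar I"
    using self_similar_limit_image[of m] m by (auto simp: assms nontrivial_self_similar_def)
  have c: "carrier G = {sq_sym t a a | t a. True}"
    unfolding assms using m by (intro symmetry_group_limit_image_generic) simp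
  then show "carrier G = generate dihedral_square {refl_diag1, refl_diag2}"
    by (simp add: generate_refl_diag)
  show "G \<cong> klein_four"
    using klein_four_iso[OF sub] c by (simp add: assms(3))
qed

end
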